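(* Let $f:\mathbb{R}^N\to\mathbb{R}^N$ be smooth and let $\Phi_h$ be a consistent one-step integrator with discrete step $h$. For any fixed composition number $S\ge1$ and truncation index $K\ge0$, there exist unique $h$-independent functions $f_k$, $0\le k\le K$, such that the numerical solution of $$\frac{d}{dt}\tilde y=f_h^K(\tilde y)=\sum_{k=0}^K h^kf_k(\tilde y)$$ satisfies $$\Phi_{h,f_h^K}(x)=\phi_{h,f}(x)+O(h^{K+2})$$ and $$\big(\Phi_{h,f_h^K}\big)^S(x)=\phi_{Sh,f}(x)+O(h^{K+2})$$ for arbitrary initial value $x$.
   Context: $\phi_{t,g}(x)$ denotes the exact solution at time $t$ of $\frac{d}{dt}y=g(y)$, $y(0)=x$, and $\Phi_{h,g}(x)$ the numerical solution after one step of size $h$ of the integrator applied to this equation. $(\Phi_{h,g})^S$ is the $S$-fold composition of $\Phi_{h,g}$ with itself. The integrator has order $p$ if $\Phi_{h,g}(x)=\phi_{h,g}(x)+O(h^{p+1})$ for every sufficiently smooth $g$ and every $x$, and is consistent if it has order $p\ge1$. The integrator is assumed to have a formal expansion $\Phi_{h,g}(x)=x+hd_{1,g}(x)+h^2d_{2,g}(x)+\cdots$ in powers of $h$, where the functions $d_{j,g}$ are given and composed of $g$ and its derivatives (for instance, for Runge-Kutta methods $d_{j,g}$ is a linear combination of elementary differentials of $g$ of order $j$); for consistent integrators $d_{1,g}=g$.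
   Formalization: The formal expansion is taken as an asymptotic expansion with remainder bounds locally uniform in the initial value and valid also for vector fields polynomial in h; an expansion holding only for each fixed g would make the claim false. *)

theory Defs
  imports "HOL-Analysis.Analysis" "HOL-Library.Landau_Symbols" "HOL-Library.FuncSet"
begin

text \<open>
  On a Euclidean space, a function all of whose directional derivatives (of the Frechet
  derivative) are \<open>C\<^sup>k\<close> is \<open>C\<^sup>k\<^sup>+\<^sup>1\<close>, so no space of multilinear maps is needed.
\<close>

primrec C_diff :: "nat \<Rightarrow> ('a::euclidean_space \<Rightarrow> 'b::real_normed_vector) \<Rightarrow> bool" where
  "C_diff 0 g \<longleftrightarrow> continuous_on UNIV g"
| "C_diff (Suc k) g \<longleftrightarrow>
     (\<forall>x. g differentiable (at x)) \<and> (\<forall>v. C_diff k (\<lambda>x. frechet_derivative g (at x) v))"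

definition smooth :: "('a::euclidean_space \<Rightarrow> 'b::real_normed_vector) \<Rightarrow> bool" where
  "smooth g \<longleftrightarrow> (\<forall>k. C_diff k g)"

text \<open>
  The time-\<open>t\<close> value of the solution of \<open>y' = g y\<close>, \<open>y 0 = x\<close>. It is only meaningful if a unique
  solution exists up to time \<open>t\<close>, which for smooth \<open>g\<close> is the case for all \<open>t\<close> close to \<open>0\<close>;
  no global existence is presupposed, since \<open>flow\<close> only enters through limits at time \<open>0\<close>.
\<close>

definition flow :: "('a::real_normed_vector \<Rightarrow> 'a) \<Rightarrow> real \<Rightarrow> 'a \<Rightarrow> 'a" where
  "flow g t x = (THE z. \<exists>y. y 0 = x \<and> y t = z \<and>
     (\<forall>s\<in>closed_segment 0 t.
        (y has_vector_derivative g (y s)) (at s within closed_segment 0 t)))"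

text \<open>An integrator maps a step size \<open>h > 0\<close> and a vector field to a one-step map. Its values
  matter only for smooth vector fields and small step sizes.\<close>

type_synonym 'n integrator = "real \<Rightarrow> (real^'n \<Rightarrow> real^'n) \<Rightarrow> real^'n \<Rightarrow> real^'n"

definition has_order :: "('n::finite) integrator \<Rightarrow> nat \<Rightarrow> bool" where
  "has_order \<Phi> p \<longleftrightarrow> (\<forall>g x. smooth g \<longrightarrow>
     (\<lambda>h. norm (\<Phi> h g x - flow g h x)) \<in> O[at_right 0](\<lambda>h. h ^ (p + 1)))"

definition consistent :: "('n::finite) integrator \<Rightarrow> bool" where
  "consistent \<Phi> \<longleftrightarrow> (\<exists>p\<ge>1. has_order \<Phi> p)"

primrec iter_deriv ::
  "'a list \<Rightarrow> ('a::real_normed_vector \<Rightarrow> 'b::real_normed_vector) \<Rightarrow> 'a \<Rightarrow> 'b" where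
  "iter_deriv [] g = g"
| "iter_deriv (v # vs) g = (\<lambda>x. frechet_derivative (iter_deriv vs g) (at x) v)"

text \<open>
  Scalar expressions composed of a vector field and its derivatives at the same point. Constants,
  sums and products are instances of the second rule, so all differential polynomials, in
  particular the components of elementary differentials and their linear combinations, are
  included.
\<close>

inductive_set diff_exprs :: "((real^'n::finite \<Rightarrow> real^'n) \<Rightarrow> real^'n \<Rightarrow> real) set" where
  deriv: "(\<lambda>g x. iter_deriv vs g x $ i) \<in> diff_exprs"
| comp: "\<lbrakk>E1 \<in> diff_exprs; E2 \<in> diff_exprs; smooth (P :: real \<times> real \<Rightarrow> real)\<rbrakk>
    \<Longrightarrow> (\<lambda>g x. P (E1 g x, E2 g x)) \<in> diff_exprs"

definition truncated_field ::
  "nat \<Rightarrow> (nat \<Rightarrow> real^'n \<Rightarrow> real^'n) \<Rightarrow> real \<Rightarrow> real^'n::finite \<Rightarrow> real^'n" where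
  "truncated_field K F h = (\<lambda>y. \<Sum>k\<le>K. h ^ k *\<^sub>R F k y)"

text \<open>
  The expansion \<open>x + h d\<^sub>1(x) + h\<^sup>2 d\<^sub>2(x) + \<dots>\<close> in the sense of asymptotic expansions; \<open>d 0\<close> is not
  used. The series need not converge. As the expansion is to be applied to vector fields which
  themselves are polynomials in \<open>h\<close>, and along iterates of the one-step map, it is required for
  such vector fields and locally uniformly in the initial value. A vector field independent of
  \<open>h\<close> is the case \<open>m = 0\<close>.
\<close>

definition has_expansion ::
  "('n::finite) integrator \<Rightarrow> (nat \<Rightarrow> (real^'n \<Rightarrow> real^'n) \<Rightarrow> real^'n \<Rightarrow> real^'n) \<Rightarrow> bool" where
  "has_expansion \<Phi> d \<longleftrightarrow>
     (\<forall>j\<ge>1. \<forall>i. (\<lambda>g x. d j g x $ i) \<in> diff_exprs) \<and>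
     (\<forall>m G J x. (\<forall>k\<le>m. smooth (G k)) \<longrightarrow>
        (\<lambda>(h, y). norm (\<Phi> h (truncated_field m G h) y
           - (y + (\<Sum>j=1..J. h ^ j *\<^sub>R d j (truncated_field m G h) y))))
        \<in> O[at_right 0 \<times>\<^sub>F nhds x](\<lambda>(h, y). h ^ (J + 1)))"

end

theory Submission imports Defs begin

text \<open>
  If two truncated fields \<open>F\<close> and \<open>G\<close> agree below the index \<open>k\<close>, then their numerical solutions
  differ by \<open>h\<^sup>k\<^sup>+\<^sup>1 (F\<^sub>k - G\<^sub>k) + O(h\<^sup>k\<^sup>+\<^sup>2)\<close>: consistency forces \<open>d\<^sub>1\<close> to be the identity, and the terms
  \<open>h\<^sup>j d\<^sub>j\<close> with \<open>j \<ge> 2\<close> change only by \<open>O(h\<^sup>k\<^sup>+\<^sup>2)\<close>, because differential expressions depend on the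
  field in a locally Lipschitz way. Hence the coefficient at which two solutions first differ would
  be visible in the one-step error, and conversely a one-step error \<open>h\<^sup>k\<^sup>+\<^sup>1 e + O(h\<^sup>k\<^sup>+\<^sup>2)\<close> is removed
  by subtracting \<open>e\<close> from \<open>F\<^sub>k\<close>. All estimates are locally uniform in the initial value, so they
  survive the \<open>S\<close>-fold composition.
\<close>

section \<open>Calculus of smooth functions\<close>

lemma C_diff_SucD: "C_diff (Suc k) g \<Longrightarrow> C_diff k g"
proof (induction k arbitrary: g)
  case 0
  then show ?case
    by (auto intro!: differentiable_imp_continuous_on simp: differentiable_on_def differentiable_at_withinI)
qed auto

text \<open>Frechet derivatives at a point are unique, so any convenient formula \<open>g'\<close>
  can stand in for \<open>frechet_derivative\<close> in the recursion of \<open>C_diff\<close>. The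
  closure rules below all go through this form.\<close>

lemma C_diff_SucI:
  assumes "\<And>x. (g has_derivative g' x) (at x)" and "\<And>v. C_diff k (\<lambda>x. g' x v)"
  shows "C_diff (Suc k) g"
  using assms frechet_derivative_at[OF assms(1)] by (auto simp: differentiable_def)

lemma C_diff_Suc_has_derivative:
  "C_diff (Suc k) g \<Longrightarrow> (g has_derivative frechet_derivative g (at x)) (at x)"
  by (auto simp: frechet_derivative_works[symmetric])

lemma C_diff_const: "C_diff k (\<lambda>x. c)"
proof (induction k arbitrary: c)
  case (Suc k)
  show ?case by (rule C_diff_SucI[where g' = "\<lambda>x v. 0"]) (auto simp: Suc)
qed auto

lemma C_diff_bounded_linear:
  assumes "bounded_linear g"
  shows "C_diff k g"
proof (cases k)
  case 0
  with assms show ?thesis by (simp add: linear_continuous_on)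
next
  case (Suc k')
  have "C_diff (Suc k') g"
    by (rule C_diff_SucI[where g' = "\<lambda>x. g"])
       (auto intro: assms bounded_linear_imp_has_derivative C_diff_const)
  with Suc show ?thesis by simp
qed

lemma C_diff_add: "C_diff k f \<Longrightarrow> C_diff k g \<Longrightarrow> C_diff k (\<lambda>x. f x + g x)"
proof (induction k arbitrary: f g)
  case (Suc k)
  note d = Suc.prems[THEN C_diff_Suc_has_derivative]
  show ?case
    by (rule C_diff_SucI[OF has_derivative_add[OF d]]) (use Suc in auto)
qed (simp add: continuous_on_add)

lemma C_diff_sum: "(\<And>i. i \<in> I \<Longrightarrow> C_diff k (f i)) \<Longrightarrow> C_diff k (\<lambda>x. \<Sum>i\<in>I. f i x)"
  by (induction I rule: infinite_finite_induct) (auto intro: C_diff_const C_diff_add)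

lemma C_diff_scaleR:
  fixes f :: "'a::euclidean_space \<Rightarrow> real" and g :: "'a \<Rightarrow> 'b::real_normed_vector"
  shows "C_diff k f \<Longrightarrow> C_diff k g \<Longrightarrow> C_diff k (\<lambda>x. f x *\<^sub>R g x)"
proof (induction k arbitrary: f g)
  case (Suc k)
  note d = Suc.prems[THEN C_diff_Suc_has_derivative]
  show ?case
    by (rule C_diff_SucI[OF has_derivative_scaleR[OF d]])
       (use Suc C_diff_SucD[OF Suc.prems(1)] C_diff_SucD[OF Suc.prems(2)] in
         \<open>auto intro!: C_diff_add\<close>)
qed (simp add: continuous_on_scaleR)

lemma C_diff_inner_left: "C_diff k g \<Longrightarrow> C_diff k (\<lambda>x. g x \<bullet> b)"
proof (induction k arbitrary: g)
  case (Suc k)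
  show ?case
    by (rule C_diff_SucI[OF has_derivative_inner_left[OF C_diff_Suc_has_derivative[OF Suc.prems]]])
       (use Suc in auto)
qed (simp add: continuous_on_inner)

text \<open>\<open>C_diff\<close> controls derivatives only in fixed directions. When the direction
  itself varies with the point, this expansion reduces to finitely many fixed basis directions with
  scalar coefficients.\<close>

lemma has_derivative_basis_expansion:
  fixes g :: "'a::euclidean_space \<Rightarrow> 'b::real_normed_vector"
  assumes "(g has_derivative g') F"
  shows "g' v = (\<Sum>b\<in>Basis. (v \<bullet> b) *\<^sub>R g' b)"
proof -
  interpret bounded_linear g' by (rule has_derivative_bounded_linear[OF assms])
  have "g' v = g' (\<Sum>b\<in>Basis. (v \<bullet> b) *\<^sub>R b)" by (simp add: euclidean_representation)
  then show ?thesis by (simp add: sum scaleR)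
qed

text \<open>In the chain rule the outer derivative is taken in the moving direction
  \<open>frechet_derivative g (at x) v\<close>. Expanded in the basis, it becomes a sum of products
  of \<open>k\<close> times differentiable functions, and the induction hypothesis handles the
  factors that are again compositions.\<close>

lemma C_diff_compose:
  fixes P :: "'b::euclidean_space \<Rightarrow> 'c::real_normed_vector" and g :: "'a::euclidean_space \<Rightarrow> 'b"
  shows "C_diff k P \<Longrightarrow> C_diff k g \<Longrightarrow> C_diff k (\<lambda>x. P (g x))"
proof (induction k arbitrary: P g)
  case 0
  then show ?case by (auto intro: continuous_on_compose2)
next
  case (Suc k)
  have d: "((\<lambda>x. P (g x)) has_derivative
      (\<lambda>v. \<Sum>b\<in>Basis. (frechet_derivative g (at x) v \<bullet> b) *\<^sub>R frechet_derivative P (at (g x)) b)) (at x)" for x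
    using has_derivative_compose[OF C_diff_Suc_has_derivative[OF Suc.prems(2)]
        C_diff_Suc_has_derivative[OF Suc.prems(1)], of x]
    by (subst has_derivative_basis_expansion[OF C_diff_Suc_has_derivative[OF Suc.prems(1)], symmetric])
  have inner: "C_diff k (\<lambda>x. frechet_derivative g (at x) v \<bullet> b)" for v b
    by (rule C_diff_inner_left) (use Suc.prems in auto)
  have outer: "C_diff k (\<lambda>x. frechet_derivative P (at (g x)) b)" for b
    by (rule Suc.IH) (use Suc.prems C_diff_SucD in auto)
  show ?case
    by (rule C_diff_SucI[OF d]) (intro C_diff_sum C_diff_scaleR inner outer)
qed

lemma smooth_const: "smooth (\<lambda>x. c)"
  and smooth_add: "smooth f \<Longrightarrow> smooth g \<Longrightarrow> smooth (\<lambda>x. f x + g x)"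
  and smooth_sum: "(\<And>i. i \<in> I \<Longrightarrow> smooth (u i)) \<Longrightarrow> smooth (\<lambda>x. \<Sum>i\<in>I. u i x)"
  and smooth_scaleR: "smooth a \<Longrightarrow> smooth f \<Longrightarrow> smooth (\<lambda>x. a x *\<^sub>R f x)"
  and smooth_bounded_linear: "bounded_linear f \<Longrightarrow> smooth f"
  for f g :: "'a::euclidean_space \<Rightarrow> 'b::real_normed_vector"
  by (auto simp: smooth_def intro: C_diff_const C_diff_add C_diff_sum C_diff_scaleR C_diff_bounded_linear)

lemma smooth_compose: "smooth P \<Longrightarrow> smooth g \<Longrightarrow> smooth (\<lambda>x. P (g x))"
  by (auto simp: smooth_def intro: C_diff_compose)

lemma smooth_uminus: "smooth f \<Longrightarrow> smooth (\<lambda>x. - f x)"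
  using smooth_scaleR[OF smooth_const[of "-1"]] by simp

lemma smooth_diff: "smooth f \<Longrightarrow> smooth g \<Longrightarrow> smooth (\<lambda>x. f x - g x)"
  using smooth_add[OF _ smooth_uminus] by simp

lemma smooth_power: "smooth f \<Longrightarrow> smooth (\<lambda>x. f x ^ k :: real)"
proof (induction k)
  case (Suc k)
  then show ?case using smooth_scaleR[of f "\<lambda>x. f x ^ k"] by simp
qed (simp add: smooth_const)

lemma smooth_Pair:
  fixes f :: "'a::euclidean_space \<Rightarrow> 'b::euclidean_space" and g :: "'a \<Rightarrow> 'c::euclidean_space"
  assumes "smooth f" "smooth g"
  shows "smooth (\<lambda>x. (f x, g x))"
proof -
  have "smooth (\<lambda>x. (f x, 0::'c) + (0::'b, g x))"
    by (intro smooth_add smooth_compose[OF _ assms(1), where P = "\<lambda>z. (z, 0)"]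
        smooth_compose[OF _ assms(2), where P = "\<lambda>z. (0, z)"] smooth_bounded_linear)
       (auto intro!: bounded_linear_intros)
  then show ?thesis by simp
qed

lemma smooth_vec:
  fixes f :: "'a::euclidean_space \<Rightarrow> real^'n::finite"
  assumes "\<And>i. smooth (\<lambda>x. f x $ i)"
  shows "smooth f"
proof -
  have "f = (\<lambda>x. \<Sum>i\<in>UNIV. (f x $ i) *\<^sub>R axis i 1)"
    by (simp add: fun_eq_iff basis_expansion flip: scalar_mult_eq_scaleR)
  moreover have "smooth (\<lambda>x. \<Sum>i\<in>UNIV. (f x $ i) *\<^sub>R axis i 1 :: real^'n)"
    by (intro smooth_sum smooth_scaleR assms smooth_const)
  ultimately show ?thesis by simp
qed

lemma smooth_frechet: "smooth g \<Longrightarrow> smooth (\<lambda>x. frechet_derivative g (at x) v)"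
  unfolding smooth_def by (metis C_diff.simps(2))

lemma smooth_has_derivative:
  "smooth g \<Longrightarrow> (g has_derivative frechet_derivative g (at x)) (at x)"
  unfolding smooth_def by (metis C_diff_Suc_has_derivative)

lemma smooth_continuous_on: "smooth g \<Longrightarrow> continuous_on A g"
  unfolding smooth_def by (metis C_diff.simps(1) continuous_on_subset subset_UNIV)

text \<open>Lie derivatives along a smooth field are smooth again, so they can be iterated; the
  Taylor coefficients of the flow arise in this way.\<close>

lemma smooth_frechet_field:
  fixes f :: "'a::euclidean_space \<Rightarrow> 'a" and u :: "'a \<Rightarrow> 'b::real_normed_vector"
  assumes "smooth u" "smooth f"
  shows "smooth (\<lambda>x. frechet_derivative u (at x) (f x))"
proof -
  have "(\<lambda>x. frechet_derivative u (at x) (f x)) =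
      (\<lambda>x. \<Sum>b\<in>Basis. (f x \<bullet> b) *\<^sub>R frechet_derivative u (at x) b)"
    using has_derivative_basis_expansion[OF smooth_has_derivative[OF assms(1)]] by blast
  moreover have "smooth (\<lambda>x. f x \<bullet> b)" for b
    by (rule smooth_compose[OF smooth_bounded_linear[OF bounded_linear_inner_left] assms(2)])
  ultimately show ?thesis
    by (simp add: smooth_sum smooth_scaleR smooth_frechet assms(1))
qed

section \<open>Bounds on compact sets and Taylor remainders\<close>

lemma smooth_bounded_on_compact:
  assumes "smooth g" "compact A"
  obtains C where "\<And>x. x \<in> A \<Longrightarrow> norm (g x) \<le> C"
  using compact_imp_bounded[OF compact_continuous_image[OF smooth_continuous_on[OF assms(1)] assms(2)]]
  by (auto simp: bounded_iff)

text \<open>The partial derivatives are bounded on the compact ball, their bounds add up to a bound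
  of the operator norm, and the mean value inequality applies because the ball is convex.\<close>

lemma smooth_lipschitz_on_cball:
  fixes g :: "'a::euclidean_space \<Rightarrow> 'b::real_normed_vector"
  assumes "smooth g"
  obtains L where "L \<ge> 0"
    "\<And>x y. x \<in> cball z r \<Longrightarrow> y \<in> cball z r \<Longrightarrow> norm (g x - g y) \<le> L * norm (x - y)"
proof -
  define D where "D x = frechet_derivative g (at x)" for x
  have "\<forall>b. \<exists>C. \<forall>x\<in>cball z r. norm (D x b) \<le> C"
    using smooth_bounded_on_compact[OF smooth_frechet[OF assms] compact_cball] unfolding D_def by metis
  then obtain C where C: "\<And>b x. x \<in> cball z r \<Longrightarrow> norm (D x b) \<le> C b" by metis
  \<comment> \<open>For negative \<open>r\<close> the ball is empty and the numbers
    \<open>C b\<close> may be negative, hence the maximum with 0.\<close>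
  define L where "L = max 0 (\<Sum>b\<in>Basis. C b)"
  have "onorm (D x) \<le> L" if x: "x \<in> cball z r" for x
  proof (rule onorm_bound)
    fix v
    have "norm (D x v) = norm (\<Sum>b\<in>Basis. (v \<bullet> b) *\<^sub>R D x b)"
      using has_derivative_basis_expansion[OF smooth_has_derivative[OF assms], of x v]
      by (simp add: D_def)
    also have "\<dots> \<le> (\<Sum>b\<in>Basis. norm v * C b)"
      by (rule sum_norm_le) (use C[OF x] in \<open>auto intro!: mult_mono simp: Basis_le_norm\<close>)
    also have "\<dots> \<le> L * norm v"
      by (simp add: L_def mult.commute[of _ "norm v"] mult_left_mono flip: sum_distrib_left)
    finally show "norm (D x v) \<le> L * norm v" .
  qed (simp add: L_def)
  then have "norm (g x - g y) \<le> L * norm (x - y)" if "x \<in> cball z r" "y \<in> cball z r" for x y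
    using that differentiable_bound[of "cball z r" g D L]
      smooth_has_derivative[OF assms] unfolding D_def
    by (metis convex_cball has_derivative_at_withinI)
  moreover have "L \<ge> 0" by (simp add: L_def)
  ultimately show thesis using that by blast
qed

text \<open>Induction on \<open>n\<close>: the derivative of the remainder of order
  \<open>Suc n\<close> is the remainder of order \<open>n\<close> of the shifted sequence
  \<open>w (Suc l)\<close>, and the mean value inequality turns a bound on it into one with an
  additional factor \<open>t\<close>. The factorial in the denominator of the sharp bound is given
  up.\<close>

lemma Taylor_vector_bound:
  fixes w :: "nat \<Rightarrow> real \<Rightarrow> 'b::real_normed_vector"
  assumes "\<And>l t. t \<in> {0..\<delta>} \<Longrightarrow> (w l has_vector_derivative w (Suc l) t) (at t within {0..\<delta>})"
    and "\<And>t. t \<in> {0..\<delta>} \<Longrightarrow> norm (w n t) \<le> C"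
    and "t \<in> {0..\<delta>}"
  shows "norm (w 0 t - (\<Sum>l<n. (t ^ l / fact l) *\<^sub>R w l 0)) \<le> C * t ^ n"
  using assms
proof (induction n arbitrary: w t)
  case (Suc n)
  define r where "r s = w 0 s - (\<Sum>l<Suc n. (s ^ l / fact l) *\<^sub>R w l 0)" for s
  define r' where "r' s = w 1 s - (\<Sum>l<n. (s ^ l / fact l) *\<^sub>R w (Suc l) 0)" for s
  \<comment> \<open>Splitting off the constant term lines up the remaining summands with those of
    \<open>r'\<close> under differentiation, and shows that \<open>r\<close> vanishes at 0.\<close>
  have r: "r s = w 0 s - (w 0 0 + (\<Sum>l<n. (s ^ Suc l / fact (Suc l)) *\<^sub>R w (Suc l) 0))" for s
    unfolding r_def by (subst sum.lessThan_Suc_shift) simp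
  have pow: "((\<lambda>s. s ^ Suc l / fact (Suc l)) has_real_derivative s ^ l / fact l) (at s within {0..t})"
    for l and s :: real
    using DERIV_cdivide[OF DERIV_pow[of "Suc l"], of "fact (Suc l)"]
    by (simp add: field_simps del: power_Suc of_nat_Suc)
  have "(r has_vector_derivative r' s) (at s within {0..t})" if "s \<in> {0..t}" for s
  proof -
    have "(w 0 has_vector_derivative w 1 s) (at s within {0..t})"
      using Suc.prems(1)[of s 0] Suc.prems(3) that
      by (auto intro: has_vector_derivative_within_subset)
    moreover have "((\<lambda>s. (s ^ Suc l / fact (Suc l)) *\<^sub>R w (Suc l) 0) has_vector_derivative
        (s ^ l / fact l) *\<^sub>R w (Suc l) 0) (at s within {0..t})" for l
      using has_vector_derivative_scaleR[OF pow[of l s] has_vector_derivative_const[of "w (Suc l) 0"]]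
      by simp
    ultimately have "((\<lambda>s. w 0 s - (w 0 0 + (\<Sum>l<n. (s ^ Suc l / fact (Suc l)) *\<^sub>R w (Suc l) 0)))
        has_vector_derivative w 1 s - (0 + (\<Sum>l<n. (s ^ l / fact l) *\<^sub>R w (Suc l) 0))) (at s within {0..t})"
      by (intro has_vector_derivative_diff has_vector_derivative_add has_vector_derivative_const
          has_vector_derivative_sum)
    then show ?thesis
      by (simp only: r[abs_def] r'_def add_0)
  qed
  moreover have "norm (r' s) \<le> C * t ^ n" if "s \<in> {0..t}" for s
  proof -
    have "norm (r' s) \<le> C * s ^ n"
      unfolding r'_def One_nat_def
      by (rule Suc.IH) (use Suc.prems that in auto)
    also have "\<dots> \<le> C * t ^ n"
      using that order_trans[OF norm_ge_zero Suc.prems(2)[OF Suc.prems(3)]]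
      by (intro mult_left_mono power_mono) auto
    finally show ?thesis .
  qed
  ultimately have "norm (r t - r 0) \<le> (C * t ^ n) * norm (t - 0)"
    using Suc.prems(3) by (intro differentiable_bound[of "{0..t}" r "\<lambda>s h. h *\<^sub>R r' s"])
       (auto simp: has_vector_derivative_def onorm_scaleR_left bounded_linear_ident onorm_id)
  moreover have "r 0 = 0" by (simp add: r)
  ultimately show ?case using Suc.prems(3) by (simp add: r_def mult_ac)
qed simp

section \<open>Local flows\<close>

text \<open>Gronwall's argument: both solutions stay in a ball on which \<open>f\<close> has
  Lipschitz constant \<open>L\<close>, and the squared distance weighted with
  \<open>exp (- 2 * L * r)\<close> has a nonpositive derivative. As it starts at 0, it stays
  0.\<close>

lemma ode_unique:
  fixes f :: "'a::euclidean_space \<Rightarrow> 'a"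
  assumes "smooth f" and y0: "y 0 = z 0"
    and y: "\<And>s. s \<in> {0..t} \<Longrightarrow> (y has_vector_derivative f (y s)) (at s within {0..t})"
    and z: "\<And>s. s \<in> {0..t} \<Longrightarrow> (z has_vector_derivative f (z s)) (at s within {0..t})"
    and s: "s \<in> {0..t}"
  shows "y s = z s"
proof -
  have cont: "continuous_on {0..t} y" "continuous_on {0..t} z"
    by (rule continuous_on_vector_derivative, erule y z)+
  then have "bounded (y ` {0..t} \<union> z ` {0..t})"
    by (simp add: compact_imp_bounded compact_continuous_image)
  then obtain R where "\<forall>v\<in>y ` {0..t} \<union> z ` {0..t}. norm v \<le> R"
    unfolding bounded_iff by (elim exE)
  then have R: "y r \<in> cball 0 R" "z r \<in> cball 0 R" if "r \<in> {0..t}" for r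
    using that by simp_all
  obtain L where L: "\<And>a b. a \<in> cball 0 R \<Longrightarrow> b \<in> cball 0 R \<Longrightarrow> norm (f a - f b) \<le> L * norm (a - b)"
    using smooth_lipschitz_on_cball[OF assms(1)] by metis
  define q where "q r = exp (- 2 * L * r) * ((y r - z r) \<bullet> (y r - z r))" for r
  define q' where "q' r = exp (- 2 * L * r) *
      (2 * ((y r - z r) \<bullet> (f (y r) - f (z r))) - 2 * L * ((y r - z r) \<bullet> (y r - z r)))" for r
  have q: "(q has_derivative (\<lambda>k. k * q' r)) (at r within {0..s})" if "r \<in> {0..s}" for r
  proof -
    have r: "r \<in> {0..t}" "{0..s} \<subseteq> {0..t}" using s that by auto
    have d: "((\<lambda>r. y r - z r) has_derivative (\<lambda>k. k *\<^sub>R (f (y r) - f (z r)))) (at r within {0..s})"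
      using has_derivative_subset[OF has_derivative_diff[OF y[OF r(1), unfolded has_vector_derivative_def]
          z[OF r(1), unfolded has_vector_derivative_def]] r(2)]
      by (simp add: scaleR_diff_right)
    have e: "((\<lambda>r. exp (- 2 * L * r)) has_derivative (\<lambda>k. k * (- 2 * L * exp (- 2 * L * r)))) (at r within {0..s})"
      by (rule derivative_eq_intros refl | simp add: fun_eq_iff)+
    show ?thesis
      unfolding q_def
      by (rule has_derivative_eq_rhs[OF has_derivative_mult[OF e has_derivative_inner[OF d d]]])
         (simp add: q'_def fun_eq_iff inner_commute algebra_simps)
  qed
  have "q s - q 0 \<le> 0"
  proof -
    obtain r where r: "r \<in> {0..s}" "q s - q 0 = (s - 0) * q' r"
      using mvt_very_simple[of 0 s q "\<lambda>r k. k * q' r"] q s by auto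
    have "(y r - z r) \<bullet> (f (y r) - f (z r)) \<le> norm (y r - z r) * norm (f (y r) - f (z r))"
      by (rule norm_cauchy_schwarz)
    also have "\<dots> \<le> norm (y r - z r) * (L * norm (y r - z r))"
      using r s by (intro mult_left_mono L R) auto
    finally have "q' r \<le> 0"
      unfolding q'_def
      by (auto intro!: mult_nonneg_nonpos simp: dot_square_norm power2_eq_square mult_ac)
    then show ?thesis using r s by (simp add: mult_nonneg_nonpos)
  qed
  then have "(y s - z s) \<bullet> (y s - z s) \<le> 0" by (simp add: q_def y0 mult_le_0_iff)
  then show ?thesis by (metis antisym inner_ge_zero inner_eq_zero_iff eq_iff_diff_eq_0)
qed

text \<open>Uniqueness makes the definite description in \<open>flow\<close> usable: any solution
  that is at hand computes it. Forward times suffice, since all asymptotics are for \<open>h\<close>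
  tending to 0 from the right.\<close>

lemma flow_eq:
  fixes f :: "'a::euclidean_space \<Rightarrow> 'a"
  assumes "smooth f" "0 \<le> t" "y 0 = x"
    and "\<And>s. s \<in> {0..t} \<Longrightarrow> (y has_vector_derivative f (y s)) (at s within {0..t})"
  shows "flow f t x = y t"
  unfolding flow_def
proof (rule the_equality)
  show "\<exists>z. z 0 = x \<and> z t = y t \<and> (\<forall>s\<in>closed_segment 0 t.
      (z has_vector_derivative f (z s)) (at s within closed_segment 0 t))"
    using assms(2-4) by (intro exI[of _ y]) (simp add: closed_segment_eq_real_ivl)
next
  fix w
  assume "\<exists>z. z 0 = x \<and> z t = w \<and> (\<forall>s\<in>closed_segment 0 t.
      (z has_vector_derivative f (z s)) (at s within closed_segment 0 t))"
  then obtain z where "z 0 = x" "z t = w" and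
    "\<And>s. s \<in> {0..t} \<Longrightarrow> (z has_vector_derivative f (z s)) (at s within {0..t})"
    using assms(2) by (auto simp: closed_segment_eq_real_ivl)
  then show "w = y t"
    using ode_unique[OF assms(1), of z y t t] assms(2-4) by simp
qed

text \<open>Picard iteration: the integral operator is a contraction on the bounded continuous
  functions with values in \<open>cball x 1\<close>. Starting in the smaller ball of radius 1/2
  leaves room for one existence time \<open>\<delta>\<close> common to all these initial
  values.\<close>

lemma ode_solution_exists:
  fixes f :: "'a::euclidean_space \<Rightarrow> 'a"
  assumes "smooth f"
  obtains \<delta> where "\<delta> > 0"
    "\<And>y. y \<in> cball x (1/2) \<Longrightarrow> \<exists>Y. Y 0 = y \<and> (\<forall>t\<in>{0..\<delta>}. Y t \<in> cball x 1 \<and>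
       (Y has_vector_derivative f (Y t)) (at t within {0..\<delta>}))"
proof -
  obtain B' where B': "\<And>y. y \<in> cball x 1 \<Longrightarrow> norm (f y) \<le> B'"
    using smooth_bounded_on_compact[OF assms compact_cball] by metis
  define B where "B = max 0 B'"
  have B: "B \<ge> 0" "\<And>y. y \<in> cball x 1 \<Longrightarrow> norm (f y) \<le> B"
    using B' by (auto simp: B_def max.coboundedI2)
  obtain L where L: "L \<ge> 0"
    "\<And>a b. a \<in> cball x 1 \<Longrightarrow> b \<in> cball x 1 \<Longrightarrow> norm (f a - f b) \<le> L * norm (a - b)"
    using smooth_lipschitz_on_cball[OF assms] by metis
  \<comment> \<open>\<open>B * \<delta> \<le> 1/2\<close> keeps the iterates within distance 1/2 of
    \<open>y\<close>, hence in \<open>cball x 1\<close>; \<open>L * \<delta> \<le> 1/2\<close> gives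
    the contraction factor 1/2.\<close>
  define \<delta> where "\<delta> = 1 / (2 * (B + L + 1))"
  have \<delta>: "\<delta> > 0" "B * \<delta> \<le> 1/2" "L * \<delta> \<le> 1/2"
    using B(1) L(1) by (auto simp: \<delta>_def field_simps)
  \<comment> \<open>Bounded continuous functions live on the whole real line, so time is clamped to
    \<open>{0..\<delta>}\<close>; on that interval \<open>c\<close> is the identity and the fixed
    point solves the equation there.\<close>
  define c where "c t = max 0 (min \<delta> t)" for t
  have c: "c t \<in> {0..\<delta>}" for t using \<delta>(1) by (auto simp: c_def)
  have "\<exists>Y. Y 0 = y \<and> (\<forall>t\<in>{0..\<delta>}. Y t \<in> cball x 1 \<and>
       (Y has_vector_derivative f (Y t)) (at t within {0..\<delta>}))" if y: "y \<in> cball x (1/2)" for y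
  proof -
    define P where "P u t = y + integral {0..c t} (\<lambda>s. f (u s))" for u :: "real \<Rightarrow>\<^sub>C 'a" and t
    define A :: "(real \<Rightarrow>\<^sub>C 'a) set" where "A = PiC UNIV (\<lambda>_. cball x 1)"
    have A: "u \<in> A \<longleftrightarrow> (\<forall>t. apply_bcontfun u t \<in> cball x 1)" for u
      by (auto simp: A_def mem_PiC_iff)
    have fu: "continuous_on I (\<lambda>s. f (apply_bcontfun u s))" for u I
      by (rule continuous_on_compose2[OF smooth_continuous_on[OF assms, of UNIV]]) auto
    have P_in: "P u t \<in> cball x 1" if "u \<in> A" for u t
    proof -
      have "norm (integral {0..c t} (\<lambda>s. f (u s))) \<le> B * (c t - 0)"
        using c[of t] that by (intro integral_bound fu) (auto intro!: B simp: A)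
      also have "\<dots> \<le> B * \<delta>" using c[of t] B(1) by (simp add: mult_left_mono)
      finally have "norm (integral {0..c t} (\<lambda>s. f (u s))) \<le> 1/2" using \<delta> by simp
      moreover have "norm (x - y) \<le> 1/2" using y by (simp add: dist_norm)
      ultimately show ?thesis
        using norm_triangle_ineq4[of "x - y" "integral {0..c t} (\<lambda>s. f (u s))"]
        by (simp add: P_def dist_norm diff_diff_eq)
    qed
    have P_bcontfun: "P u \<in> bcontfun" if "u \<in> A" for u
    proof -
      have "continuous_on UNIV (\<lambda>t. integral {0..c t} (\<lambda>s. f (u s)))"
        by (rule continuous_on_compose2[OF indefinite_integral_continuous_1[OF integrable_continuous_real[OF fu]]])
           (use c in \<open>auto simp: c_def intro!: continuous_intros\<close>)
      then have "continuous_on UNIV (P u)"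
        unfolding P_def by (intro continuous_on_add continuous_on_const)
      moreover have "bounded (range (P u))"
        by (rule bounded_subset[OF bounded_cball[of x 1]]) (use P_in[OF that] in auto)
      ultimately show ?thesis by (simp add: bcontfun_def)
    qed
    have P: "apply_bcontfun (Bcontfun (P u)) = P u" if "u \<in> A" for u
      using P_bcontfun[OF that] by (simp add: Bcontfun_inverse)
    have "\<exists>!u\<in>A. Bcontfun (P u) = u"
    proof (rule Banach_fix)
      show "complete A"
        unfolding A_def complete_eq_closed by (intro closed_PiC) auto
      have "const_bcontfun x \<in> A" by (simp add: A const_bcontfun.rep_eq)
      then show "A \<noteq> {}" by blast
      show "(\<lambda>u. Bcontfun (P u)) ` A \<subseteq> A"
        using P P_in by (auto simp: A)
      show "dist (Bcontfun (P u)) (Bcontfun (P v)) \<le> 1/2 * dist u v" if uv: "u \<in> A" "v \<in> A" for u v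
        proof (rule dist_bound)
          fix t
          have le: "norm (f (u s) - f (v s)) \<le> L * dist u v" for s
          proof -
            have "norm (f (u s) - f (v s)) \<le> L * norm (u s - v s)"
              using uv by (intro L) (auto simp: A)
            also have "\<dots> \<le> L * dist u v"
              using dist_bounded[of u s v] L(1) by (intro mult_left_mono) (auto simp: dist_norm)
            finally show ?thesis .
          qed
          have "P u t - P v t = integral {0..c t} (\<lambda>s. f (u s) - f (v s))"
            by (simp add: P_def integral_diff integrable_continuous_real fu)
          also have "norm \<dots> \<le> L * dist u v * (c t - 0)"
            using c[of t] by (intro integral_bound continuous_on_diff fu le) auto
          also have "\<dots> \<le> L * dist u v * \<delta>"
            using c[of t] L(1) by (simp add: mult_left_mono)
          also have "\<dots> \<le> 1/2 * dist u v"
            using mult_right_mono[OF \<delta>(3), of "dist u v"] by (simp add: mult_ac)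
          finally show "dist (Bcontfun (P u) t) (Bcontfun (P v) t) \<le> 1/2 * dist u v"
            using uv by (simp add: P dist_norm)
        qed
    qed auto
    then obtain u where u: "u \<in> A" "Bcontfun (P u) = u" by blast
    then have uP: "apply_bcontfun u = P u" using P by metis
    have "(apply_bcontfun u has_vector_derivative f (u t)) (at t within {0..\<delta>})" if t: "t \<in> {0..\<delta>}" for t
    proof -
      have "((\<lambda>t. y + integral {0..t} (\<lambda>s. f (u s))) has_vector_derivative 0 + f (u t)) (at t within {0..\<delta>})"
        by (intro has_vector_derivative_add has_vector_derivative_const integral_has_vector_derivative fu t)
      moreover have "apply_bcontfun u s = y + integral {0..s} (\<lambda>s. f (u s))" if "s \<in> {0..\<delta>}" for s
        using fun_cong[OF uP, of s] that by (simp add: P_def c_def)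
      ultimately show ?thesis
        using has_vector_derivative_transform[OF t] by (metis (no_types, lifting) add_0)
    qed
    moreover have "apply_bcontfun u 0 = y" using fun_cong[OF uP, of 0] \<delta>(1) by (simp add: P_def c_def)
    ultimately show ?thesis using u(1) by (intro exI[of _ "apply_bcontfun u"]) (simp add: A)
  qed
  with \<delta>(1) show thesis by (rule that)
qed

lemma flow_solves_ode:
  fixes f :: "'a::euclidean_space \<Rightarrow> 'a"
  assumes "smooth f"
  obtains \<delta> where "\<delta> > 0"
    "\<And>y. y \<in> cball x (1/2) \<Longrightarrow> flow f 0 y = y"
    "\<And>y t. y \<in> cball x (1/2) \<Longrightarrow> t \<in> {0..\<delta>} \<Longrightarrow> flow f t y \<in> cball x 1"
    "\<And>y t. y \<in> cball x (1/2) \<Longrightarrow> t \<in> {0..\<delta>} \<Longrightarrow>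
       ((\<lambda>s. flow f s y) has_vector_derivative f (flow f t y)) (at t within {0..\<delta>})"
proof -
  obtain \<delta> where \<delta>: "\<delta> > 0" and ex: "\<And>y. y \<in> cball x (1/2) \<Longrightarrow>
      \<exists>Y. Y 0 = y \<and> (\<forall>t\<in>{0..\<delta>}. Y t \<in> cball x 1 \<and>
       (Y has_vector_derivative f (Y t)) (at t within {0..\<delta>}))"
    using ode_solution_exists[OF assms] by metis
  then obtain Y where Y: "\<And>y. y \<in> cball x (1/2) \<Longrightarrow> Y y 0 = y \<and> (\<forall>t\<in>{0..\<delta>}. Y y t \<in> cball x 1 \<and>
       (Y y has_vector_derivative f (Y y t)) (at t within {0..\<delta>}))"
    by metis
  have flow: "flow f t y = Y y t" if "y \<in> cball x (1/2)" "t \<in> {0..\<delta>}" for y t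
    using Y[OF that(1)] that(2)
    by (intro flow_eq assms) (auto intro!: has_vector_derivative_within_subset[of "Y y" _ _ "{0..\<delta>}" "{0..t}"])
  show thesis
  proof (rule that[OF \<delta>])
    fix y assume y: "y \<in> cball x (1/2)"
    show "flow f 0 y = y" using flow[OF y, of 0] Y[OF y] \<delta> by simp
    fix t assume t: "t \<in> {0..\<delta>}"
    have "Y y t \<in> cball x 1" using Y[OF y] t by blast
    then show "flow f t y \<in> cball x 1" by (simp only: flow[OF y t])
    have "(Y y has_vector_derivative f (flow f t y)) (at t within {0..\<delta>})"
      using Y[OF y] t by (simp only: flow[OF y t])
    then show "((\<lambda>s. flow f s y) has_vector_derivative f (flow f t y)) (at t within {0..\<delta>})"
      by (rule has_vector_derivative_transform[OF t, rotated]) (rule flow[OF y])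
  qed
qed

text \<open>The time-shifted trajectory solves the equation with initial value
  \<open>flow f s x\<close>. Existence up to \<open>\<delta>\<close> has to be supplied because
  solutions are only local.\<close>

lemma flow_add:
  fixes f :: "'a::euclidean_space \<Rightarrow> 'a"
  assumes "smooth f" "0 \<le> s" "0 \<le> t" "s + t \<le> \<delta>"
    and "\<And>r. r \<in> {0..\<delta>} \<Longrightarrow> ((\<lambda>r. flow f r x) has_vector_derivative f (flow f r x)) (at r within {0..\<delta>})"
  shows "flow f t (flow f s x) = flow f (s + t) x"
proof (rule flow_eq[OF assms(1,3)])
  fix r assume r: "r \<in> {0..t}"
  have "((\<lambda>r. flow f r x) \<circ> (\<lambda>r. s + r) has_vector_derivative 1 *\<^sub>R f (flow f (s + r) x)) (at r within {0..t})"
  proof (rule vector_diff_chain_within)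
    show "((\<lambda>r. flow f r x) has_vector_derivative f (flow f (s + r) x)) (at (s + r) within (\<lambda>r. s + r) ` {0..t})"
      by (rule has_vector_derivative_within_subset[OF assms(5)]) (use assms r in auto)
    show "((\<lambda>r. s + r) has_vector_derivative 1) (at r within {0..t})"
      using has_vector_derivative_add[OF has_vector_derivative_const has_vector_derivative_id] by simp
  qed
  then show "((\<lambda>r. flow f (s + r) x) has_vector_derivative f (flow f (s + r) x)) (at r within {0..t})"
    by (simp add: o_def)
qed simp

section \<open>Locally uniform asymptotics\<close>

text \<open>The product filter lets the constant and the range of \<open>h\<close> depend on
  \<open>x\<close> but requires them to serve all initial values near \<open>x\<close>. This is what
  is needed to evaluate an estimate at points that move with \<open>h\<close>.\<close>

definition loc_bigo :: "nat \<Rightarrow> (real \<Rightarrow> 'a::topological_space \<Rightarrow> 'b::real_normed_vector) \<Rightarrow> bool" where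
  "loc_bigo k u \<longleftrightarrow>
     (\<forall>x. (\<lambda>(h, y). norm (u h y)) \<in> O[at_right 0 \<times>\<^sub>F nhds x](\<lambda>(h, y). h ^ k))"

lemma norm_bigo_add:
  fixes u v :: "'a \<Rightarrow> 'b::real_normed_vector" and g :: "'a \<Rightarrow> real"
  assumes "(\<lambda>z. norm (u z)) \<in> O[F](g)" "(\<lambda>z. norm (v z)) \<in> O[F](g)"
  shows "(\<lambda>z. norm (u z + v z)) \<in> O[F](g)"
  by (rule landau_o.big_trans[OF landau_o.big_mono sum_in_bigo(1)[OF assms]])
     (simp add: norm_triangle_ineq)

lemma norm_bigo_diff:
  fixes u v :: "'a \<Rightarrow> 'b::real_normed_vector" and g :: "'a \<Rightarrow> real"
  assumes "(\<lambda>z. norm (u z)) \<in> O[F](g)" "(\<lambda>z. norm (v z)) \<in> O[F](g)"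
  shows "(\<lambda>z. norm (u z - v z)) \<in> O[F](g)"
  using norm_bigo_add[of u F g "\<lambda>z. - v z"] assms by simp

lemma eventually_at_right_prod_nhds:
  fixes x :: "'a::metric_space"
  assumes "\<delta> > 0" "\<And>h y. h \<in> {0<..<\<delta>} \<Longrightarrow> y \<in> ball x \<delta> \<Longrightarrow> P h y"
  shows "\<forall>\<^sub>F (h, y) in at_right (0::real) \<times>\<^sub>F nhds x. P h y"
  unfolding eventually_prod_filter
proof (intro exI conjI allI impI)
  show "\<forall>\<^sub>F h in at_right 0. h \<in> {0<..<\<delta>}"
    using assms(1) by (rule eventually_at_right_real)
  show "\<forall>\<^sub>F y in nhds x. y \<in> ball x \<delta>"
    using assms(1) by (intro eventually_nhds_in_open) auto
qed (use assms(2) in auto)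

lemma loc_bigoI:
  fixes u :: "real \<Rightarrow> 'a::metric_space \<Rightarrow> 'b::real_normed_vector"
  assumes "\<And>x. \<exists>C. \<exists>\<delta>>0. \<forall>h\<in>{0<..<\<delta>}. \<forall>y\<in>ball x \<delta>. norm (u h y) \<le> C * h ^ k"
  shows "loc_bigo k u"
  unfolding loc_bigo_def
proof
  fix x
  obtain C \<delta> where "\<delta> > 0" "\<And>h y. h \<in> {0<..<\<delta>} \<Longrightarrow> y \<in> ball x \<delta> \<Longrightarrow> norm (u h y) \<le> C * h ^ k"
    using assms[of x] by metis
  then have "\<forall>\<^sub>F (h, y) in at_right 0 \<times>\<^sub>F nhds x. norm (norm (u h y)) \<le> C * norm (h ^ k)"
    by (intro eventually_at_right_prod_nhds[of \<delta>]) (auto simp: power_abs)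
  then show "(\<lambda>(h, y). norm (u h y)) \<in> O[at_right 0 \<times>\<^sub>F nhds x](\<lambda>(h, y). h ^ k)"
    by (intro bigoI[of _ C]) (simp add: case_prod_unfold)
qed

lemma loc_bigo_add: "loc_bigo k u \<Longrightarrow> loc_bigo k v \<Longrightarrow> loc_bigo k (\<lambda>h y. u h y + v h y)"
  unfolding loc_bigo_def case_prod_unfold by (intro allI norm_bigo_add; simp)

lemma loc_bigo_diff: "loc_bigo k u \<Longrightarrow> loc_bigo k v \<Longrightarrow> loc_bigo k (\<lambda>h y. u h y - v h y)"
  unfolding loc_bigo_def case_prod_unfold by (intro allI norm_bigo_diff; simp)

lemma loc_bigo_zero: "loc_bigo k (\<lambda>h y. 0)"
  by (simp add: loc_bigo_def case_prod_unfold)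

lemma loc_bigo_sum: "(\<And>i. i \<in> I \<Longrightarrow> loc_bigo k (u i)) \<Longrightarrow> loc_bigo k (\<lambda>h y. \<Sum>i\<in>I. u i h y)"
  by (induction I rule: infinite_finite_induct) (simp_all add: loc_bigo_zero loc_bigo_add)

lemma loc_bigo_vec:
  fixes u :: "real \<Rightarrow> 'a::topological_space \<Rightarrow> real^'n::finite"
  assumes "\<And>i. loc_bigo k (\<lambda>h y. u h y $ i)"
  shows "loc_bigo k u"
  unfolding loc_bigo_def
proof
  fix x :: 'a
  have "(\<lambda>z. \<Sum>i\<in>UNIV. norm (u (fst z) (snd z) $ i)) \<in> O[at_right 0 \<times>\<^sub>F nhds x](\<lambda>z. fst z ^ k)"
    by (rule big_sum_in_bigo) (use assms in \<open>auto simp: loc_bigo_def case_prod_unfold\<close>)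
  then show "(\<lambda>(h, y). norm (u h y)) \<in> O[at_right 0 \<times>\<^sub>F nhds x](\<lambda>(h, y). h ^ k)"
    unfolding case_prod_unfold
    by (rule landau_o.big_trans[OF landau_o.big_mono, rotated])
       (simp add: sum_nonneg norm_le_l1_cart)
qed

lemma loc_bigo_power:
  assumes "loc_bigo k u"
  shows "loc_bigo (j + k) (\<lambda>h y. h ^ j *\<^sub>R u h y)"
  unfolding loc_bigo_def
proof
  fix x
  show "(\<lambda>(h, y). norm (h ^ j *\<^sub>R u h y)) \<in> O[at_right 0 \<times>\<^sub>F nhds x](\<lambda>(h, y). h ^ (j + k))"
    using landau_o.big.mult[of "\<lambda>z. \<bar>fst z ^ j\<bar>" "at_right 0 \<times>\<^sub>F nhds x" "\<lambda>z. fst z ^ j"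
        "\<lambda>z. norm (u (fst z) (snd z))" "\<lambda>z. fst z ^ k"] assms
    by (simp add: loc_bigo_def case_prod_unfold power_add)
qed

lemma eventually_power_le_at_right:
  assumes "j \<le> k"
  shows "\<forall>\<^sub>F h in at_right 0. \<bar>h ^ k\<bar> \<le> \<bar>h ^ j :: real\<bar>"
  by (rule eventually_mono[OF eventually_at_right_real[OF zero_less_one]])
     (use assms in \<open>auto simp: power_decreasing\<close>)

lemma loc_bigo_mono:
  fixes u :: "real \<Rightarrow> 'a::topological_space \<Rightarrow> 'b::real_normed_vector"
  assumes "loc_bigo k u" "j \<le> k"
  shows "loc_bigo j u"
  unfolding loc_bigo_def
proof
  fix x :: 'a
  have "\<forall>\<^sub>F (h, y) in at_right (0::real) \<times>\<^sub>F nhds x. \<bar>h ^ k\<bar> \<le> \<bar>h ^ j\<bar>"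
    using eventually_power_le_at_right[OF assms(2)] by (simp add: eventually_prod1)
  then have "(\<lambda>(h, y). h ^ k) \<in> O[at_right (0::real) \<times>\<^sub>F nhds x](\<lambda>(h, y). h ^ j)"
    by (intro landau_o.big_mono) (simp add: case_prod_unfold)
  then show "(\<lambda>(h, y). norm (u h y)) \<in> O[at_right 0 \<times>\<^sub>F nhds x](\<lambda>(h, y). h ^ j)"
    using assms(1) landau_o.big_trans unfolding loc_bigo_def by blast
qed

text \<open>The initial value may depend on \<open>h\<close> as long as it converges. Constant
  \<open>a\<close> yields the pointwise estimates of the theorem; the numerical iterates are the
  case that needs local uniformity.\<close>

lemma loc_bigo_compose:
  assumes "loc_bigo k u" "(a \<longlongrightarrow> x) (at_right 0)"
  shows "(\<lambda>h. norm (u h (a h))) \<in> O[at_right 0](\<lambda>h. h ^ k)"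
proof -
  have "filterlim (\<lambda>h. (h, a h)) (at_right 0 \<times>\<^sub>F nhds x) (at_right 0)"
    using assms(2) by (intro filterlim_Pair filterlim_ident)
  then show ?thesis
    using landau_o.big.compose[of "\<lambda>(h, y). norm (u h y)" "at_right 0 \<times>\<^sub>F nhds x" "\<lambda>(h, y). h ^ k"] assms(1)
    unfolding loc_bigo_def by fastforce
qed

text \<open>Joint smoothness includes \<open>h = 0\<close>, so \<open>u\<close> is bounded on a
  compact neighbourhood of \<open>(0, x)\<close>.\<close>

lemma smooth_loc_bigo_0:
  fixes u :: "real \<Rightarrow> 'a::euclidean_space \<Rightarrow> 'b::real_normed_vector"
  assumes "smooth (\<lambda>(h, y). u h y)"
  shows "loc_bigo 0 u"
proof (rule loc_bigoI)
  fix x :: 'a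
  have "compact ({0..1::real} \<times> cball x 1)" by (intro compact_Times compact_Icc compact_cball)
  from smooth_bounded_on_compact[OF assms this] obtain C
    where "\<And>z. z \<in> {0..1} \<times> cball x 1 \<Longrightarrow> norm ((\<lambda>(h, y). u h y) z) \<le> C" by metis
  then have "norm (u h y) \<le> C" if "h \<in> {0<..<1}" "y \<in> ball x 1" for h y
    using that by (force simp: less_imp_le)
  then show "\<exists>C. \<exists>\<delta>>0. \<forall>h\<in>{0<..<\<delta>}. \<forall>y\<in>ball x \<delta>. norm (u h y) \<le> C * h ^ 0"
    by (intro exI[of _ C] exI[of _ 1]) auto
qed

lemma smooth_snd_loc_bigo_0: "smooth g \<Longrightarrow> loc_bigo 0 (\<lambda>h. g)"
  for g :: "'a::euclidean_space \<Rightarrow> 'b::real_normed_vector"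
  unfolding case_prod_unfold
  by (intro smooth_loc_bigo_0, unfold case_prod_unfold)
     (rule smooth_compose[OF _ smooth_bounded_linear[OF bounded_linear_snd]])

text \<open>Near \<open>h = 0\<close> both arguments lie in a common ball, and \<open>P\<close> is
  Lipschitz there.\<close>

lemma loc_bigo_smooth_compose:
  fixes P :: "'b::euclidean_space \<Rightarrow> 'c::real_normed_vector"
    and a b :: "real \<Rightarrow> 'a::topological_space \<Rightarrow> 'b"
  assumes "smooth P" "loc_bigo 0 a" "loc_bigo 0 b" "loc_bigo k (\<lambda>h y. a h y - b h y)"
  shows "loc_bigo k (\<lambda>h y. P (a h y) - P (b h y))"
  unfolding loc_bigo_def
proof
  fix x :: 'a
  obtain R1 R2 where
    "\<forall>\<^sub>F (h, y) in at_right 0 \<times>\<^sub>F nhds x. norm (a h y) \<le> R1"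
    "\<forall>\<^sub>F (h, y) in at_right 0 \<times>\<^sub>F nhds x. norm (b h y) \<le> R2"
    using assms(2,3) by (fastforce simp: loc_bigo_def case_prod_unfold elim!: landau_o.bigE)
  then have R: "\<forall>\<^sub>F (h, y) in at_right 0 \<times>\<^sub>F nhds x.
      a h y \<in> cball 0 (max R1 R2) \<and> b h y \<in> cball 0 (max R1 R2)"
    by eventually_elim auto
  obtain L where L: "L \<ge> 0" "\<And>p q. p \<in> cball 0 (max R1 R2) \<Longrightarrow> q \<in> cball 0 (max R1 R2) \<Longrightarrow>
      norm (P p - P q) \<le> L * norm (p - q)"
    using smooth_lipschitz_on_cball[OF assms(1)] by metis
  have "(\<lambda>(h, y). norm (P (a h y) - P (b h y)))
      \<in> O[at_right 0 \<times>\<^sub>F nhds x](\<lambda>(h, y). norm (a h y - b h y))"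
    by (rule bigoI[of _ L], rule eventually_mono[OF R]) (use L(2) in auto)
  then show "(\<lambda>(h, y). norm (P (a h y) - P (b h y))) \<in> O[at_right 0 \<times>\<^sub>F nhds x](\<lambda>(h, y). h ^ k)"
    using assms(4) landau_o.big_trans unfolding loc_bigo_def by blast
qed

section \<open>Expansions in the step size\<close>

text \<open>Dividing by \<open>h ^ k\<close> leaves \<open>norm c \<le> C * h\<close>, whose
  right-hand side tends to 0.\<close>

lemma leading_coefficient_eq_0:
  fixes c :: "'a::real_normed_vector"
  assumes "(\<lambda>h. norm (h ^ k *\<^sub>R c)) \<in> O[at_right 0](\<lambda>h. h ^ Suc k)"
  shows "c = 0"
proof -
  from assms obtain C where "\<forall>\<^sub>F h in at_right 0. norm (norm (h ^ k *\<^sub>R c)) \<le> C * norm (h ^ Suc k :: real)"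
    by (elim landau_o.bigE)
  moreover have "\<forall>\<^sub>F h in at_right 0. (0::real) < h" by (rule eventually_at_right_less)
  ultimately have "\<forall>\<^sub>F h in at_right 0. norm c \<le> C * h"
    by eventually_elim (simp add: power_abs)
  moreover have "((\<lambda>h::real. C * h) \<longlongrightarrow> C * 0) (at_right 0)"
    by (intro tendsto_intros)
  ultimately have "norm c \<le> C * 0"
    by (intro tendsto_lowerbound[of _ "C * 0" "at_right (0::real)"]) auto
  then show ?thesis by simp
qed

lemma loc_bigo_leading_eq_0:
  assumes "loc_bigo (Suc k) (\<lambda>h y. h ^ k *\<^sub>R e y)"
  shows "e y = 0"
  using loc_bigo_compose[OF assms, of "\<lambda>_. y" y] by (auto intro: leading_coefficient_eq_0)

lemma smooth_Taylor_time:
  fixes u :: "real \<Rightarrow> 'a::euclidean_space \<Rightarrow> 'b::real_normed_vector"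
  assumes "smooth (\<lambda>(h, y). u h y)"
  obtains e where "\<And>l. smooth (e l)"
    "\<And>n. loc_bigo n (\<lambda>h y. u h y - (\<Sum>l<n. h ^ l *\<^sub>R e l y))"
proof -
  \<comment> \<open>Differentiating in the direction \<open>(1, 0)\<close> is the partial derivative
    in \<open>h\<close>, so \<open>U l\<close> is the \<open>l\<close>-th one. Being taken of a
    jointly smooth function, it is still smooth in the initial value.\<close>
  define U where "U l = ((\<lambda>g p. frechet_derivative g (at p) (1, 0)) ^^ l) (\<lambda>(h, y). u h y)" for l
  have U: "smooth (U l)" for l
    by (induction l) (simp_all add: U_def assms smooth_frechet)
  have U_0: "U 0 = (\<lambda>(h, y). u h y)" by (simp add: U_def)
  have deriv: "((\<lambda>t. U l (t, y)) has_vector_derivative U (Suc l) (t, y)) (at t within A)" for l t y A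
  proof -
    have "(U l \<circ> (\<lambda>t. (t, y)) has_derivative
        frechet_derivative (U l) (at (t, y)) \<circ> (\<lambda>k. (k, 0))) (at t)"
      by (intro diff_chain_at smooth_has_derivative U has_derivative_Pair has_derivative_ident
          has_derivative_const)
    moreover have bl: "bounded_linear (frechet_derivative (U l) (at (t, y)))"
      by (rule has_derivative_bounded_linear[OF smooth_has_derivative[OF U]])
    have "frechet_derivative (U l) (at (t, y)) (k, 0) = k *\<^sub>R U (Suc l) (t, y)" for k
      using linear_scale[OF bounded_linear.linear[OF bl], of k "(1, 0)"]
      by (simp add: U_def)
    ultimately show ?thesis
      by (auto simp: has_vector_derivative_def o_def intro: has_derivative_at_withinI)
  qed
  show thesis
  proof
    show "smooth (\<lambda>y. (1 / fact l) *\<^sub>R U l (0, y))" for l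
      by (intro smooth_scaleR smooth_const smooth_compose[OF U] smooth_bounded_linear)
         (auto intro!: bounded_linear_intros)
    show "loc_bigo n (\<lambda>h y. u h y - (\<Sum>l<n. h ^ l *\<^sub>R (1 / fact l) *\<^sub>R U l (0, y)))" for n
    proof (rule loc_bigoI)
      fix x :: 'a
      have "compact ({0..1::real} \<times> cball x 1)" by (intro compact_Times compact_Icc compact_cball)
      from smooth_bounded_on_compact[OF U this] obtain C
        where C: "\<And>z. z \<in> {0..1} \<times> cball x 1 \<Longrightarrow> norm (U n z) \<le> C" by metis
      have "norm (u h y - (\<Sum>l<n. h ^ l *\<^sub>R (1 / fact l) *\<^sub>R U l (0, y))) \<le> C * h ^ n"
        if "h \<in> {0<..<1}" "y \<in> ball x 1" for h y
        using Taylor_vector_bound[where w = "\<lambda>l t. U l (t, y)" and \<delta> = 1 and t = h and n = n and C = C,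
            OF deriv] C that by (simp add: U_0)
      then show "\<exists>C. \<exists>\<delta>>0. \<forall>h\<in>{0<..<\<delta>}. \<forall>y\<in>ball x \<delta>.
          norm (u h y - (\<Sum>l<n. h ^ l *\<^sub>R (1 / fact l) *\<^sub>R U l (0, y))) \<le> C * h ^ n"
        by (intro exI[of _ C] exI[of _ 1]) auto
    qed
  qed
qed

text \<open>The Taylor coefficients in \<open>h\<close> below the index \<open>k\<close> vanish one
  after the other: once the earlier ones are gone, \<open>h ^ l *\<^sub>R e l y\<close> is a
  difference of two terms of order \<open>Suc l\<close>. The coefficient at \<open>k\<close> is then
  the leading term.\<close>

lemma smooth_loc_bigo_leading_term:
  fixes u :: "real \<Rightarrow> 'a::euclidean_space \<Rightarrow> 'b::real_normed_vector"
  assumes "smooth (\<lambda>(h, y). u h y)" "loc_bigo k u"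
  obtains e where "smooth e" "loc_bigo (Suc k) (\<lambda>h y. u h y - h ^ k *\<^sub>R e y)"
proof -
  obtain e where e: "\<And>l. smooth (e l)"
    "\<And>n. loc_bigo n (\<lambda>h y. u h y - (\<Sum>l<n. h ^ l *\<^sub>R e l y))"
    by (rule smooth_Taylor_time[OF assms(1)]) blast
  have zero: "e l y = 0" if "l < k" for l y
    using that
  proof (induction l arbitrary: y rule: less_induct)
    case (less l)
    have "loc_bigo (Suc l) (\<lambda>h y. u h y - (u h y - (\<Sum>i<Suc l. h ^ i *\<^sub>R e i y)))"
      using less.prems by (intro loc_bigo_diff e(2) loc_bigo_mono[OF assms(2)]) auto
    then have "loc_bigo (Suc l) (\<lambda>h y. h ^ l *\<^sub>R e l y)"
      using less.prems less.IH by simp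
    then show ?case by (rule loc_bigo_leading_eq_0)
  qed
  show thesis
    using that[of "e k"] e(1) e(2)[of "Suc k"] zero by simp
qed

lemma flow_Taylor:
  fixes f :: "'a::euclidean_space \<Rightarrow> 'a"
  assumes "smooth f"
  obtains D where "\<And>l. smooth (D l)" "D 1 = f"
    "\<And>n. loc_bigo (Suc n) (\<lambda>h y. flow f h y - (y + (\<Sum>j=1..n. h ^ j *\<^sub>R D j y)))"
proof -
  \<comment> \<open>\<open>U l\<close> is the \<open>l\<close>-th Lie derivative of the identity
    along \<open>f\<close>. Along a trajectory the time derivative of \<open>U l\<close> is
    \<open>U (Suc l)\<close>, so \<open>U l\<close> divided by \<open>fact l\<close> is the Taylor
    coefficient of the flow.\<close>
  define U where "U l = ((\<lambda>g p. frechet_derivative g (at p) (f p)) ^^ l) (\<lambda>y. y)" for l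
  have U: "smooth (U l)" for l
    by (induction l)
       (simp_all add: U_def assms smooth_frechet_field smooth_bounded_linear bounded_linear_ident)
  show thesis
  proof
    show "smooth (\<lambda>y. (1 / fact l) *\<^sub>R U l y)" for l
      by (intro smooth_scaleR smooth_const U)
    have "frechet_derivative (\<lambda>y. y) (at x) = (\<lambda>v. v)" for x :: 'a
      by (simp add: frechet_derivative_at[symmetric] has_derivative_ident)
    then show "(\<lambda>y. (1 / fact 1) *\<^sub>R U 1 y) = f"
      by (simp add: U_def)
    show "loc_bigo (Suc n) (\<lambda>h y. flow f h y - (y + (\<Sum>j=1..n. h ^ j *\<^sub>R (1 / fact j) *\<^sub>R U j y)))" for n
    proof (rule loc_bigoI)
      fix x :: 'a
      obtain C where C: "\<And>z. z \<in> cball x 1 \<Longrightarrow> norm (U (Suc n) z) \<le> C"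
        using smooth_bounded_on_compact[OF U compact_cball] by metis
      obtain \<delta> where \<delta>: "\<delta> > 0"
        and 0: "\<And>y. y \<in> cball x (1/2) \<Longrightarrow> flow f 0 y = y"
        and ball: "\<And>y t. y \<in> cball x (1/2) \<Longrightarrow> t \<in> {0..\<delta>} \<Longrightarrow> flow f t y \<in> cball x 1"
        and ode: "\<And>y t. y \<in> cball x (1/2) \<Longrightarrow> t \<in> {0..\<delta>} \<Longrightarrow>
          ((\<lambda>s. flow f s y) has_vector_derivative f (flow f t y)) (at t within {0..\<delta>})"
        using flow_solves_ode[OF assms] by metis
      have "norm (flow f h y - (y + (\<Sum>j=1..n. h ^ j *\<^sub>R (1 / fact j) *\<^sub>R U j y))) \<le> C * h ^ Suc n"
        if h: "h \<in> {0..\<delta>}" and y: "y \<in> cball x (1/2)" for h y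
      proof -
        have "((\<lambda>t. U l (flow f t y)) has_vector_derivative U (Suc l) (flow f t y)) (at t within {0..\<delta>})"
          if "t \<in> {0..\<delta>}" for l t
          using vector_derivative_diff_chain_within[OF ode[OF y that]
              has_derivative_at_withinI[OF smooth_has_derivative[OF U[of l]]]]
          by (simp add: U_def o_def)
        then have "norm (U 0 (flow f h y) - (\<Sum>l<Suc n. (h ^ l / fact l) *\<^sub>R U l (flow f 0 y))) \<le> C * h ^ Suc n"
          by (rule Taylor_vector_bound[where \<delta> = \<delta>]) (use C ball[OF y] h in auto)
        moreover have "(\<Sum>l<Suc n. (h ^ l / fact l) *\<^sub>R U l (flow f 0 y)) =
            y + (\<Sum>j=1..n. h ^ j *\<^sub>R (1 / fact j) *\<^sub>R U j y)"
          by (subst sum.lessThan_Suc_shift)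
             (simp add: 0[OF y] U_def sum.atLeast1_atMost_eq del: funpow.simps power_Suc)
        ultimately show ?thesis by (simp add: U_def)
      qed
      then show "\<exists>C. \<exists>\<delta>>0. \<forall>h\<in>{0<..<\<delta>}. \<forall>y\<in>ball x \<delta>.
          norm (flow f h y - (y + (\<Sum>j=1..n. h ^ j *\<^sub>R (1 / fact j) *\<^sub>R U j y))) \<le> C * h ^ Suc n"
        using \<delta> by (intro exI[of _ C] exI[of _ "min \<delta> (1/2)"]) auto
    qed
  qed
qed

section \<open>Modified vector fields\<close>

lemma smooth_iter_deriv: "smooth g \<Longrightarrow> smooth (iter_deriv vs g)"
  by (induction vs) (simp_all add: smooth_frechet)

text \<open>Spatial derivatives act on each coefficient separately, so the dependence on
  \<open>h\<close> remains polynomial. Joint smoothness and the comparison of two truncated fields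
  can both be read off from this.\<close>

lemma iter_deriv_truncated_field:
  assumes "\<And>k. k \<le> m \<Longrightarrow> smooth (G k)"
  shows "iter_deriv vs (truncated_field m G h) y = (\<Sum>k\<le>m. h ^ k *\<^sub>R iter_deriv vs (G k) y)"
proof (induction vs arbitrary: y)
  case (Cons v vs)
  have "iter_deriv vs (truncated_field m G h) = (\<lambda>y. \<Sum>k\<le>m. h ^ k *\<^sub>R iter_deriv vs (G k) y)"
    using Cons by (rule ext)
  moreover have "((\<lambda>y. \<Sum>k\<le>m. h ^ k *\<^sub>R iter_deriv vs (G k) y) has_derivative
      (\<lambda>v. \<Sum>k\<le>m. h ^ k *\<^sub>R frechet_derivative (iter_deriv vs (G k)) (at y) v)) (at y)"
    by (intro has_derivative_sum has_derivative_scaleR_right smooth_has_derivative smooth_iter_deriv assms)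
       simp
  ultimately show ?case by (simp add: frechet_derivative_at[symmetric])
qed (simp add: truncated_field_def)

lemma smooth_truncated_field:
  "(\<And>k. k \<le> m \<Longrightarrow> smooth (G k)) \<Longrightarrow> smooth (truncated_field m G h)"
  unfolding truncated_field_def by (intro smooth_sum smooth_scaleR smooth_const) simp

lemma smooth_power_scaleR_snd:
  fixes g :: "'a::euclidean_space \<Rightarrow> 'b::real_normed_vector"
  assumes "smooth g"
  shows "smooth (\<lambda>(h, y). h ^ k *\<^sub>R g y)"
  unfolding case_prod_unfold
  by (intro smooth_scaleR smooth_power smooth_compose[OF assms] smooth_bounded_linear
      bounded_linear_fst bounded_linear_snd)

lemma smooth_vec_nth: "smooth (f :: 'a::euclidean_space \<Rightarrow> real^'n::finite) \<Longrightarrow> smooth (\<lambda>x. f x $ i)"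
  by (rule smooth_compose[where P = "\<lambda>v. v $ i"]) (simp_all add: smooth_bounded_linear bounded_linear_vec_nth)

text \<open>Smoothness is joint in step size and initial value, which allows Taylor expansion in
  \<open>h\<close> at \<open>h = 0\<close> of the expansion coefficients evaluated at a truncated
  field.\<close>

lemma smooth_diff_expr:
  fixes G :: "nat \<Rightarrow> real^'n::finite \<Rightarrow> real^'n"
  assumes "E \<in> diff_exprs" and "\<And>k. k \<le> m \<Longrightarrow> smooth (G k)"
  shows "smooth (\<lambda>(h, y). E (truncated_field m G h) y)"
  using assms(1)
proof induction
  case (deriv vs i)
  have "smooth (\<lambda>z. \<Sum>k\<le>m. fst z ^ k *\<^sub>R iter_deriv vs (G k) (snd z))"
    using smooth_power_scaleR_snd[OF smooth_iter_deriv[OF assms(2)]]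
    by (intro smooth_sum) (simp add: case_prod_unfold)
  from smooth_vec_nth[OF this, of i] show ?case
    by (simp add: case_prod_unfold iter_deriv_truncated_field assms(2))
next
  case (comp E1 E2 P)
  show ?case
    using smooth_compose[OF comp.hyps(3) smooth_Pair[OF comp.IH]] by (simp add: case_prod_unfold)
qed

text \<open>For a single derivative, only coefficients with index at least \<open>k\<close> survive
  in the difference, and they carry powers \<open>h ^ j\<close> with \<open>j \<ge> k\<close>.
  Composition with a smooth \<open>P\<close> preserves the order since \<open>P\<close> is locally
  Lipschitz.\<close>

lemma diff_expr_perturbation:
  fixes F G :: "nat \<Rightarrow> real^'n::finite \<Rightarrow> real^'n"
  assumes "E \<in> diff_exprs"
    and F: "\<And>k. k \<le> m \<Longrightarrow> smooth (F k)" and G: "\<And>k. k \<le> m \<Longrightarrow> smooth (G k)"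
    and eq: "\<And>i. i < k \<Longrightarrow> F i = G i"
  shows "loc_bigo k (\<lambda>h y. E (truncated_field m F h) y - E (truncated_field m G h) y)"
  using assms(1)
proof induction
  case (deriv vs i)
  define v where "v j y = (iter_deriv vs (F j) y - iter_deriv vs (G j) y) $ i" for j y
  have v: "smooth (v j)" if "j \<le> m" for j
    unfolding v_def using that by (intro smooth_vec_nth smooth_diff smooth_iter_deriv F G)
  have "loc_bigo k (\<lambda>h y. h ^ j *\<^sub>R v j y)" if "j \<le> m" for j
  proof (cases "j < k")
    case True
    then show ?thesis by (simp add: v_def eq loc_bigo_zero)
  next
    case False
    then show ?thesis
      using loc_bigo_power[OF smooth_snd_loc_bigo_0[OF v[OF that]], of j]
      by (intro loc_bigo_mono[of j _ k]) auto
  qed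
  then have "loc_bigo k (\<lambda>h y. \<Sum>j\<le>m. h ^ j *\<^sub>R v j y)"
    by (intro loc_bigo_sum) simp
  then show ?case
    by (simp add: iter_deriv_truncated_field F G v_def sum_subtractf right_diff_distrib)
next
  case (comp E1 E2 P)
  have "loc_bigo k (\<lambda>h y. P (E1 (truncated_field m F h) y, E2 (truncated_field m F h) y)
      - P (E1 (truncated_field m G h) y, E2 (truncated_field m G h) y))"
  proof (rule loc_bigo_smooth_compose[OF comp.hyps(3)])
    note diff_sm = smooth_diff_expr[OF comp.hyps(1)] smooth_diff_expr[OF comp.hyps(2)]
    show "loc_bigo 0 (\<lambda>h y. (E1 (truncated_field m F h) y, E2 (truncated_field m F h) y))"
      using smooth_Pair[OF diff_sm[where G = F and m = m]] F
      by (intro smooth_loc_bigo_0) (simp add: case_prod_unfold)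
    show "loc_bigo 0 (\<lambda>h y. (E1 (truncated_field m G h) y, E2 (truncated_field m G h) y))"
      using smooth_Pair[OF diff_sm[where G = G and m = m]] G
      by (intro smooth_loc_bigo_0) (simp add: case_prod_unfold)
    have "loc_bigo k (\<lambda>h y. (E1 (truncated_field m F h) y - E1 (truncated_field m G h) y)
           *\<^sub>R ((1, 0) :: real \<times> real)
        + (E2 (truncated_field m F h) y - E2 (truncated_field m G h) y) *\<^sub>R (0, 1))"
    proof (rule loc_bigo_add)
      have "loc_bigo k (\<lambda>h y. u h y *\<^sub>R c)" if "loc_bigo k u" "norm c = 1"
        for u :: "real \<Rightarrow> real^'n \<Rightarrow> real" and c :: "real \<times> real"
        using that by (simp add: loc_bigo_def)
      note this[OF comp.IH(1), of "(1, 0)"] this[OF comp.IH(2), of "(0, 1)"]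
      then show "loc_bigo k (\<lambda>h y. (E1 (truncated_field m F h) y - E1 (truncated_field m G h) y)
           *\<^sub>R ((1, 0) :: real \<times> real))"
        "loc_bigo k (\<lambda>h y. (E2 (truncated_field m F h) y - E2 (truncated_field m G h) y)
           *\<^sub>R ((0, 1) :: real \<times> real))"
        by (simp_all add: norm_Pair)
    qed
    then show "loc_bigo k (\<lambda>h y. (E1 (truncated_field m F h) y, E2 (truncated_field m F h) y)
        - (E1 (truncated_field m G h) y, E2 (truncated_field m G h) y))"
      by simp
  qed
  then show ?case .
qed

section \<open>The integrator's expansion and the modified field\<close>

context
  fixes \<Phi> :: "('n::finite) integrator" and d :: "nat \<Rightarrow> (real^'n \<Rightarrow> real^'n) \<Rightarrow> real^'n \<Rightarrow> real^'n"
  assumes expansion: "has_expansion \<Phi> d" and consistent: "consistent \<Phi>"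
begin

lemma expansion_loc_bigo:
  assumes "\<And>k. k \<le> m \<Longrightarrow> smooth (G k)"
  shows "loc_bigo (Suc J) (\<lambda>h y. \<Phi> h (truncated_field m G h) y
           - (y + (\<Sum>j=1..J. h ^ j *\<^sub>R d j (truncated_field m G h) y)))"
  using expansion assms unfolding has_expansion_def loc_bigo_def by simp

lemma coefficient_diff_expr: "j \<ge> 1 \<Longrightarrow> (\<lambda>g x. d j g x $ i) \<in> diff_exprs"
  using expansion unfolding has_expansion_def by blast

lemma smooth_coefficient:
  assumes "j \<ge> 1" "\<And>k. k \<le> m \<Longrightarrow> smooth (G k)"
  shows "smooth (\<lambda>(h, y). d j (truncated_field m G h) y)"
  using smooth_diff_expr[OF coefficient_diff_expr[OF assms(1)] assms(2)]
  by (intro smooth_vec) (simp add: case_prod_unfold)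

lemma coefficient_perturbation:
  assumes "j \<ge> 1" "\<And>k. k \<le> m \<Longrightarrow> smooth (F k)" "\<And>k. k \<le> m \<Longrightarrow> smooth (G k)"
    "\<And>i. i < k \<Longrightarrow> F i = G i"
  shows "loc_bigo k (\<lambda>h y. d j (truncated_field m F h) y - d j (truncated_field m G h) y)"
  using diff_expr_perturbation[OF coefficient_diff_expr[OF assms(1)] assms(2-4)]
  by (intro loc_bigo_vec) simp

text \<open>The numerical and the exact solution agree up to terms of order \<open>h ^ 2\<close>,
  and their expansions start with \<open>x + h * d 1 g x\<close> and \<open>x + h * g x\<close>, so
  the coefficients of \<open>h\<close> coincide.\<close>

lemma first_coefficient:
  assumes "smooth g"
  shows "d 1 g = g"
proof
  fix x
  obtain p where p: "p \<ge> 1" "has_order \<Phi> p" using consistent unfolding consistent_def by blast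
  have "(\<lambda>h::real. h ^ (p + 1)) \<in> O[at_right 0](\<lambda>h. h ^ 2)"
    using eventually_power_le_at_right[of 2 "p + 1"] p(1) by (intro landau_o.big_mono) simp
  with p(2) assms have order: "(\<lambda>h. norm (\<Phi> h g x - flow g h x)) \<in> O[at_right 0](\<lambda>h. h ^ 2)"
    unfolding has_order_def by (blast intro: landau_o.big_trans)
  \<comment> \<open>A truncated field with \<open>m = 0\<close> is the field \<open>g\<close>
    itself, independent of \<open>h\<close>.\<close>
  have "loc_bigo (Suc 1) (\<lambda>h y. \<Phi> h (truncated_field 0 (\<lambda>_. g) h) y
           - (y + (\<Sum>j=1..1. h ^ j *\<^sub>R d j (truncated_field 0 (\<lambda>_. g) h) y)))"
    by (rule expansion_loc_bigo) (rule assms)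
  then have "loc_bigo 2 (\<lambda>h y. \<Phi> h g y - (y + h *\<^sub>R d 1 g y))"
    by (simp add: truncated_field_def numeral_2_eq_2)
  note num = loc_bigo_compose[OF this tendsto_const, of x]
  obtain D where "D 1 = g"
    "\<And>n. loc_bigo (Suc n) (\<lambda>h y. flow g h y - (y + (\<Sum>j=1..n. h ^ j *\<^sub>R D j y)))"
    by (rule flow_Taylor[OF assms]) blast
  from this(1) this(2)[of 1] have "loc_bigo 2 (\<lambda>h y. flow g h y - (y + h *\<^sub>R g y))"
    by (simp add: numeral_2_eq_2)
  note exact = loc_bigo_compose[OF this tendsto_const, of x]
  have "(\<lambda>h. norm (h ^ 1 *\<^sub>R (d 1 g x - g x))) \<in> O[at_right 0](\<lambda>h. h ^ Suc 1)"
    using norm_bigo_diff[OF norm_bigo_add[OF order exact] num]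
    by (simp add: algebra_simps numeral_2_eq_2)
  then show "d 1 g x = g x" using leading_coefficient_eq_0[of 1 "d 1 g x - g x"] by simp
qed

lemma expansion_perturbation:
  assumes F: "\<And>k. k \<le> m \<Longrightarrow> smooth (F k)" and G: "\<And>k. k \<le> m \<Longrightarrow> smooth (G k)"
    and eq: "\<And>i. i < k \<Longrightarrow> F i = G i" and k: "k \<le> m"
  shows "loc_bigo (k + 2) (\<lambda>h y. (\<Sum>j=1..Suc n. h ^ j *\<^sub>R d j (truncated_field m F h) y)
     - (\<Sum>j=1..Suc n. h ^ j *\<^sub>R d j (truncated_field m G h) y) - h ^ (k + 1) *\<^sub>R (F k y - G k y))"
proof -
  \<comment> \<open>Here \<open>j\<close> counts powers of \<open>h\<close> after multiplication of
    the field by \<open>h\<close>, so the coefficient with index \<open>j - 1\<close> belongs to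
    \<open>h ^ j\<close>. The removed index \<open>k + 1\<close> is the leading term; smaller
    \<open>j\<close> contribute nothing, larger ones have order at least
    \<open>k + 2\<close>.\<close>
  have "loc_bigo (k + 2) (\<lambda>h y. h ^ j *\<^sub>R (F (j - 1) y - G (j - 1) y))"
    if "j \<in> {1..Suc m} - {k + 1}" for j
  proof (cases "j < k + 1")
    case True
    with that have "F (j - 1) = G (j - 1)" by (intro eq) auto
    then show ?thesis by (simp add: loc_bigo_zero)
  next
    case False
    with that show ?thesis
      using loc_bigo_power[OF smooth_snd_loc_bigo_0[OF smooth_diff[OF F G]], of "j - 1" "j - 1" j]
      by (intro loc_bigo_mono[of j _ "k + 2"]) auto
  qed
  then have "loc_bigo (k + 2) (\<lambda>h y. \<Sum>j\<in>{1..Suc m} - {k + 1}. h ^ j *\<^sub>R (F (j - 1) y - G (j - 1) y))"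
    by (rule loc_bigo_sum)
  moreover have "(\<Sum>j\<in>{1..Suc m} - {k + 1}. h ^ j *\<^sub>R (F (j - 1) y - G (j - 1) y)) =
     h *\<^sub>R d 1 (truncated_field m F h) y - h *\<^sub>R d 1 (truncated_field m G h) y
       - h ^ (k + 1) *\<^sub>R (F k y - G k y)" for h y
  proof -
    \<comment> \<open>For each fixed \<open>h\<close> the truncated field is a smooth field in its
      own right, so \<open>first_coefficient\<close> applies to it.\<close>
    have d1: "d 1 (truncated_field m F h) = truncated_field m F h"
      "d 1 (truncated_field m G h) = truncated_field m G h"
      by (intro first_coefficient smooth_truncated_field F G; assumption)+
    have "h *\<^sub>R d 1 (truncated_field m F h) y - h *\<^sub>R d 1 (truncated_field m G h) y =
        (\<Sum>j\<le>m. h ^ Suc j *\<^sub>R (F j y - G j y))"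
      unfolding d1
      by (simp add: truncated_field_def scaleR_sum_right sum_subtractf scaleR_diff_right)
    also have "\<dots> = (\<Sum>j=1..Suc m. h ^ j *\<^sub>R (F (j - 1) y - G (j - 1) y))"
      by (simp only: One_nat_def sum.atLeast1_atMost_eq lessThan_Suc_atMost diff_Suc_Suc diff_zero)
    finally show ?thesis using k by (simp add: sum_diff1)
  qed
  ultimately have first: "loc_bigo (k + 2) (\<lambda>h y. h *\<^sub>R d 1 (truncated_field m F h) y
      - h *\<^sub>R d 1 (truncated_field m G h) y - h ^ (k + 1) *\<^sub>R (F k y - G k y))"
    by simp
  \<comment> \<open>The coefficients \<open>d j\<close> change by order \<open>k\<close>, and
    \<open>j \<ge> 2\<close> supplies the two missing powers of \<open>h\<close>.\<close>
  have "loc_bigo (k + 2)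
      (\<lambda>h y. h ^ j *\<^sub>R (d j (truncated_field m F h) y - d j (truncated_field m G h) y))"
    if "j \<in> {2..Suc n}" for j
  proof (rule loc_bigo_mono[OF loc_bigo_power])
    show "loc_bigo k (\<lambda>h y. d j (truncated_field m F h) y - d j (truncated_field m G h) y)"
      using that by (intro coefficient_perturbation F G eq) auto
  qed (use that in auto)
  then have "loc_bigo (k + 2) (\<lambda>h y. \<Sum>j=2..Suc n.
      h ^ j *\<^sub>R (d j (truncated_field m F h) y - d j (truncated_field m G h) y))"
    by (rule loc_bigo_sum)
  moreover have split: "(\<Sum>j=1..Suc n. a j) = a 1 + (\<Sum>j=2..Suc n. a j)" for a :: "nat \<Rightarrow> real^'n"
    using sum.atLeast_Suc_atMost[of 1 "Suc n" a] by (simp add: numeral_2_eq_2 del: sum.cl_ivl_Suc)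
  ultimately show ?thesis
    using loc_bigo_add[OF first, of "\<lambda>h y. \<Sum>j=2..Suc n.
      h ^ j *\<^sub>R (d j (truncated_field m F h) y - d j (truncated_field m G h) y)"]
    by (simp add: split sum_subtractf scaleR_diff_right algebra_simps del: sum.cl_ivl_Suc One_nat_def)
qed

lemma exists_modified_field:
  assumes "smooth f"
  obtains F where "\<And>k. smooth (F k)"
    "loc_bigo (K + 2) (\<lambda>h y. \<Phi> h (truncated_field K F h) y - flow f h y)"
proof -
  obtain D where D: "\<And>l. smooth (D l)" and
    D_bigo: "\<And>n. loc_bigo (Suc n) (\<lambda>h y. flow f h y - (y + (\<Sum>j=1..n. h ^ j *\<^sub>R D j y)))"
    by (rule flow_Taylor[OF assms]) blast
  \<comment> \<open>\<open>\<Phi>\<close> need not be smooth in \<open>h\<close>, so the leading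
    error is read off from the difference \<open>W\<close> of the two truncated expansions. It is
    jointly smooth and differs from the true error by terms of order \<open>K + 2\<close>.\<close>
  define W where "W F h y = (\<Sum>j=1..Suc K. h ^ j *\<^sub>R d j (truncated_field K F h) y)
      - (\<Sum>j=1..Suc K. h ^ j *\<^sub>R D j y)" for F h y
  have W: "smooth (\<lambda>(h, y). W F h y)" "loc_bigo 1 (W F)" if F: "\<And>k. smooth (F k)" for F
  proof -
    have d: "smooth (\<lambda>(h, y). d j (truncated_field K F h) y)" if "j \<in> {1..Suc K}" for j
      using that F by (intro smooth_coefficient) auto
    have "smooth (\<lambda>z. fst z ^ j *\<^sub>R d j (truncated_field K F (fst z)) (snd z))" if "j \<in> {1..Suc K}" for j
      by (rule smooth_scaleR[OF smooth_power[OF smooth_bounded_linear[OF bounded_linear_fst]]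
            d[OF that, unfolded case_prod_unfold]])
    moreover have "smooth (\<lambda>z. fst z ^ j *\<^sub>R D j (snd z))" for j
      using smooth_power_scaleR_snd[OF D] by (simp add: case_prod_unfold)
    ultimately show "smooth (\<lambda>(h, y). W F h y)"
      unfolding W_def case_prod_unfold by (intro smooth_diff smooth_sum)
    have pow: "loc_bigo 1 (\<lambda>h y. h ^ j *\<^sub>R u h y)" if "loc_bigo 0 u" "j \<in> {1..Suc K}"
      for u :: "real \<Rightarrow> real^'n \<Rightarrow> real^'n" and j
      using loc_bigo_power[OF that(1), of j] that(2) by (intro loc_bigo_mono[of j _ 1]) auto
    show "loc_bigo 1 (W F)"
      unfolding W_def[abs_def]
    proof (intro loc_bigo_diff loc_bigo_sum)
      fix j assume j: "j \<in> {1..Suc K}"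
      show "loc_bigo 1 (\<lambda>h y. h ^ j *\<^sub>R d j (truncated_field K F h) y)"
        by (rule pow[OF smooth_loc_bigo_0[OF d[OF j]] j])
      show "loc_bigo 1 (\<lambda>h y. h ^ j *\<^sub>R D j y)"
        by (rule pow[OF smooth_snd_loc_bigo_0[OF D] j])
    qed
  qed
  \<comment> \<open>After \<open>k\<close> corrections the coefficients below \<open>k\<close> are
    settled. The zero field starts the induction, because every term of \<open>W\<close> has a
    factor \<open>h\<close>.\<close>
  have "\<exists>F. (\<forall>k. smooth (F k)) \<and> loc_bigo (k + 1) (W F)" if "k \<le> K + 1" for k
    using that
  proof (induction k)
    case 0
    show ?case using W(2)[of "\<lambda>_ _. 0", OF smooth_const]
      by (intro exI[of _ "\<lambda>_ _. 0"]) (simp add: smooth_const)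
  next
    case (Suc k)
    then obtain F where F: "\<And>k. smooth (F k)" "loc_bigo (k + 1) (W F)" by auto
    obtain e where e: "smooth e" "loc_bigo (Suc (k + 1)) (\<lambda>h y. W F h y - h ^ (k + 1) *\<^sub>R e y)"
      by (rule smooth_loc_bigo_leading_term[OF W(1)[OF F(1)] F(2)]) blast
    \<comment> \<open>Lowering the coefficient \<open>F k\<close> by \<open>e\<close> changes
      \<open>W\<close> by \<open>- h ^ (k + 1) *\<^sub>R e y\<close> up to order
      \<open>k + 2\<close>, which cancels the leading term.\<close>
    define F' where "F' = F(k := \<lambda>y. F k y - e y)"
    have F': "smooth (F' i)" for i
      using F(1) e(1) by (simp add: F'_def smooth_diff)
    have "loc_bigo (k + 2) (\<lambda>h y. (\<Sum>j=1..Suc K. h ^ j *\<^sub>R d j (truncated_field K F' h) y)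
        - (\<Sum>j=1..Suc K. h ^ j *\<^sub>R d j (truncated_field K F h) y) - h ^ (k + 1) *\<^sub>R (F' k y - F k y))"
      using Suc.prems by (intro expansion_perturbation F F') (auto simp: F'_def)
    from loc_bigo_add[OF this, of "\<lambda>h y. W F h y - h ^ (k + 1) *\<^sub>R e y"] e(2)
    have "loc_bigo (Suc k + 1) (W F')"
      by (simp add: W_def[abs_def] F'_def algebra_simps del: sum.cl_ivl_Suc)
    with F' show ?case by blast
  qed
  from this[of "K + 1"] obtain F where F: "\<And>k. smooth (F k)" "loc_bigo (K + 2) (W F)" by auto
  show thesis
  proof (rule that[OF F(1)])
    have "loc_bigo (Suc (Suc K)) (\<lambda>h y. \<Phi> h (truncated_field K F h) y
           - (y + (\<Sum>j=1..Suc K. h ^ j *\<^sub>R d j (truncated_field K F h) y)))"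
      by (rule expansion_loc_bigo) (rule F)
    from loc_bigo_diff[OF loc_bigo_add[OF this, of "W F"] D_bigo[of "Suc K"]] F(2)
    show "loc_bigo (K + 2) (\<lambda>h y. \<Phi> h (truncated_field K F h) y - flow f h y)"
      by (simp add: W_def[abs_def] algebra_simps del: sum.cl_ivl_Suc)
  qed
qed

text \<open>By strong induction let \<open>F\<close> and \<open>G\<close> agree below
  \<open>k\<close>. The common target \<open>u\<close> cancels in the difference of the two
  estimates, so the numerical solutions differ by order \<open>K + 2\<close>, hence by order
  \<open>k + 2\<close>; their difference also has the leading term
  \<open>h ^ (k + 1) *\<^sub>R (F k x - G k x)\<close>, which therefore vanishes.\<close>

lemma modified_field_unique:
  assumes F: "\<And>k. k \<le> K \<Longrightarrow> smooth (F k)" and G: "\<And>k. k \<le> K \<Longrightarrow> smooth (G k)"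
    and "\<And>x. (\<lambda>h. norm (\<Phi> h (truncated_field K F h) x - u h x)) \<in> O[at_right 0](\<lambda>h. h ^ (K + 2))"
    and "\<And>x. (\<lambda>h. norm (\<Phi> h (truncated_field K G h) x - u h x)) \<in> O[at_right 0](\<lambda>h. h ^ (K + 2))"
    and "k \<le> K"
  shows "F k = G k"
  using assms(5)
proof (induction k rule: less_induct)
  case (less k)
  show ?case
  proof
    fix x
    have le: "v \<in> O[at_right 0](\<lambda>h. h ^ (K + 2)) \<Longrightarrow> v \<in> O[at_right 0](\<lambda>h. h ^ (k + 2))"
      for v :: "real \<Rightarrow> real"
      using less.prems
      using eventually_power_le_at_right[of "k + 2" "K + 2"]
      by (elim landau_o.big_trans, intro landau_o.big_mono) simp
    have exp: "(\<lambda>h. norm (\<Phi> h (truncated_field K H h) x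
           - (x + (\<Sum>j=1..Suc K. h ^ j *\<^sub>R d j (truncated_field K H h) x)))) \<in> O[at_right 0](\<lambda>h. h ^ (k + 2))"
      if "\<And>k. k \<le> K \<Longrightarrow> smooth (H k)" for H
    proof -
      have "loc_bigo (Suc (Suc K)) (\<lambda>h y. \<Phi> h (truncated_field K H h) y
           - (y + (\<Sum>j=1..Suc K. h ^ j *\<^sub>R d j (truncated_field K H h) y)))"
        by (rule expansion_loc_bigo) (rule that)
      from loc_bigo_compose[OF this tendsto_const, of x] show ?thesis
        by (intro le) simp
    qed
    have pert: "(\<lambda>h. norm ((\<Sum>j=1..Suc K. h ^ j *\<^sub>R d j (truncated_field K F h) x)
       - (\<Sum>j=1..Suc K. h ^ j *\<^sub>R d j (truncated_field K G h) x) - h ^ (k + 1) *\<^sub>R (F k x - G k x)))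
       \<in> O[at_right 0](\<lambda>h. h ^ (k + 2))"
      by (rule loc_bigo_compose[OF expansion_perturbation tendsto_const]) (use F G less in auto)
    note expF = exp[of F, OF F] and expG = exp[of G, OF G]
    have "(\<lambda>h. norm (h ^ (k + 1) *\<^sub>R (F k x - G k x))) \<in> O[at_right 0](\<lambda>h. h ^ (k + 2))"
      using norm_bigo_diff[OF norm_bigo_add[OF norm_bigo_diff[OF le[OF assms(3)[of x]] le[OF assms(4)[of x]]]
            norm_bigo_diff[OF expG expF]] pert]
      by (simp add: algebra_simps del: sum.cl_ivl_Suc)
    then show "F k x = G k x"
      using leading_coefficient_eq_0[of "k + 1" "F k x - G k x"] by simp
  qed
qed

end

section \<open>Error propagation under iteration\<close>

text \<open>Induction on the number of steps, comparing the numerical point \<open>a\<close> with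
  the exact point \<open>b\<close>. The new error splits into the one-step error at
  \<open>a\<close>, the Taylor errors of the flow at \<open>a\<close> and at \<open>b\<close>, and
  the difference of the Taylor polynomials \<open>T\<close> at the two points. Using
  \<open>T\<close> in place of the flow gives Lipschitz dependence on the initial value
  directly.\<close>

lemma composition_bigo:
  fixes f :: "'a::euclidean_space \<Rightarrow> 'a" and \<Psi> :: "real \<Rightarrow> 'a \<Rightarrow> 'a"
  assumes f: "smooth f" and \<Psi>: "loc_bigo (Suc n) (\<lambda>h y. \<Psi> h y - flow f h y)"
  shows "(\<lambda>h. norm ((\<Psi> h ^^ s) x - flow f (real s * h) x)) \<in> O[at_right 0](\<lambda>h. h ^ Suc n)"
proof -
  obtain D where D: "\<And>l. smooth (D l)" and
    D_bigo: "\<And>n. loc_bigo (Suc n) (\<lambda>h y. flow f h y - (y + (\<Sum>j=1..n. h ^ j *\<^sub>R D j y)))"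
    by (rule flow_Taylor[OF f]) blast
  define T where "T z = snd z + (\<Sum>j=1..n. fst z ^ j *\<^sub>R D j (snd z))" for z :: "real \<times> 'a"
  have T: "smooth T"
    unfolding T_def
    by (rule smooth_add[OF smooth_bounded_linear[OF bounded_linear_snd]
          smooth_sum[OF smooth_power_scaleR_snd[OF D, unfolded case_prod_unfold]]])
  have T_bigo: "loc_bigo (Suc n) (\<lambda>h y. flow f h y - T (h, y))"
    using D_bigo[of n] by (simp add: T_def)
  obtain L where L: "\<And>p q. p \<in> cball (0, x) 1 \<Longrightarrow> q \<in> cball (0, x) 1 \<Longrightarrow> norm (T p - T q) \<le> L * norm (p - q)"
    using smooth_lipschitz_on_cball[OF T] by metis
  obtain \<delta> where \<delta>: "\<delta> > 0"
    and flow_0': "\<And>y. y \<in> cball x (1/2) \<Longrightarrow> flow f 0 y = y"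
    and ode': "\<And>y t. y \<in> cball x (1/2) \<Longrightarrow> t \<in> {0..\<delta>} \<Longrightarrow>
      ((\<lambda>s. flow f s y) has_vector_derivative f (flow f t y)) (at t within {0..\<delta>})"
    by (rule flow_solves_ode[OF f, of x]) blast
  have flow_0: "flow f 0 x = x" by (rule flow_0') simp
  have ode: "((\<lambda>s. flow f s x) has_vector_derivative f (flow f t x)) (at t within {0..\<delta>})"
    if "t \<in> {0..\<delta>}" for t
    by (rule ode'[OF _ that]) simp
  have cont: "continuous_on {0..\<delta>} (\<lambda>s. flow f s x)"
    by (rule continuous_on_vector_derivative) (rule ode)
  have flow_lim: "((\<lambda>h. flow f (real s * h) x) \<longlongrightarrow> x) (at_right 0)" for s
  proof -
    have "((\<lambda>h. real s * h) \<longlongrightarrow> real s * 0) (at_right 0)"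
      by (intro tendsto_intros)
    moreover have "\<forall>\<^sub>F h in at_right 0. real s * h \<in> {0..\<delta>}"
    proof (rule eventually_mono)
      show "\<forall>\<^sub>F h in at_right 0. h \<in> {0<..<\<delta> / (real s + 1)}"
        using \<delta> by (intro eventually_at_right_real) simp
    qed (auto simp: field_simps)
    ultimately show ?thesis
      using continuous_on_tendsto_compose[OF cont, of "\<lambda>h. real s * h" 0 "at_right 0"] \<delta>
      by (simp add: flow_0)
  qed
  show ?thesis
  proof (induction s)
    case 0
    show ?case by (simp add: flow_0)
  next
    case (Suc s)
    define a where "a h = (\<Psi> h ^^ s) x" for h
    define b where "b h = flow f (real s * h) x" for h
    have ab: "(\<lambda>h. norm (a h - b h)) \<in> O[at_right 0](\<lambda>h. h ^ Suc n)"
      using Suc.IH by (simp add: a_def b_def)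
    have b: "(b \<longlongrightarrow> x) (at_right 0)"
      unfolding b_def by (rule flow_lim)
    \<comment> \<open>The numerical points converge to \<open>x\<close> as well, so that the locally
      uniform estimates may be evaluated along them.\<close>
    have "((\<lambda>h. a h - b h) \<longlongrightarrow> 0) (at_right 0)"
    proof -
      obtain C where "\<forall>\<^sub>F h in at_right 0. norm (norm (a h - b h)) \<le> C * norm (h ^ Suc n)"
        using ab by (elim landau_o.bigE)
      moreover have "((\<lambda>h::real. C * norm (h ^ Suc n)) \<longlongrightarrow> C * norm ((0::real) ^ Suc n)) (at_right 0)"
        by (intro tendsto_intros)
      ultimately show ?thesis
        by (intro Lim_null_comparison[of "\<lambda>h. a h - b h" "\<lambda>h. C * norm (h ^ Suc n)"]) auto
    qed
    from tendsto_add[OF this b] have a: "(a \<longlongrightarrow> x) (at_right 0)" by simp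
    have near: "\<forall>\<^sub>F h in at_right 0. (h, c h) \<in> cball (0, x) 1" if "(c \<longlongrightarrow> x) (at_right 0)" for c
    proof -
      have "((\<lambda>h. (h, c h)) \<longlongrightarrow> (0, x)) (at_right 0)"
        using that by (intro tendsto_Pair) auto
      from tendstoD[OF this zero_less_one] show ?thesis
        by (rule eventually_mono) (simp add: dist_commute)
    qed
    have "\<forall>\<^sub>F h in at_right 0. norm (T (h, a h) - T (h, b h)) \<le> L * norm (a h - b h)"
      using near[OF a] near[OF b]
    proof eventually_elim
      case (elim h)
      then show ?case using L[of "(h, a h)" "(h, b h)"] by (simp add: norm_Pair)
    qed
    then have "(\<lambda>h. norm (T (h, a h) - T (h, b h))) \<in> O[at_right 0](\<lambda>h. norm (a h - b h))"
      by (intro bigoI[of _ L]) simp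
    note Lip = landau_o.big_trans[OF this ab]
    note A = loc_bigo_compose[OF \<Psi> a] and B = loc_bigo_compose[OF T_bigo a]
      and C = loc_bigo_compose[OF T_bigo b]
    have "(\<lambda>h. norm (\<Psi> h (a h) - flow f h (b h))) \<in> O[at_right 0](\<lambda>h. h ^ Suc n)"
      using norm_bigo_diff[OF norm_bigo_add[OF norm_bigo_add[OF A B] Lip] C] by simp
    \<comment> \<open>For small \<open>h\<close> all \<open>Suc s\<close> steps fit into the
      existence time \<open>\<delta>\<close>, where the flow property holds.\<close>
    moreover have "\<forall>\<^sub>F h in at_right 0. flow f h (b h) = flow f (real (Suc s) * h) x"
    proof (rule eventually_mono)
      show "\<forall>\<^sub>F h in at_right 0. h \<in> {0<..<\<delta> / real (Suc s)}"
        using \<delta> by (intro eventually_at_right_real) simp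
      fix h assume "h \<in> {0<..<\<delta> / real (Suc s)}"
      then have "flow f h (flow f (real s * h) x) = flow f (real s * h + h) x"
        by (intro flow_add[OF f _ _ _ ode]) (auto simp: field_simps)
      then show "flow f h (b h) = flow f (real (Suc s) * h) x"
        by (simp add: b_def algebra_simps)
    qed
    ultimately show ?case
      by (subst landau_o.big.in_cong[of _ "\<lambda>h. norm (\<Psi> h (a h) - flow f h (b h))"])
         (auto simp: a_def elim!: eventually_mono)
  qed
qed

section \<open>Existence and uniqueness of the modified coefficients\<close>

theorem theorem4:
  fixes f :: "real^'n::finite \<Rightarrow> real^'n"
    and \<Phi> :: "'n integrator"
    and d :: "nat \<Rightarrow> (real^'n \<Rightarrow> real^'n) \<Rightarrow> real^'n \<Rightarrow> real^'n"
    and S K :: nat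
  assumes "smooth f"
    and "has_expansion \<Phi> d"
    and "consistent \<Phi>"
    and "S \<ge> 1"
  shows "\<exists>!F. F \<in> {..K} \<rightarrow>\<^sub>E {g :: real^'n \<Rightarrow> real^'n. smooth g} \<and>
     (\<forall>x. (\<lambda>h. norm (\<Phi> h (truncated_field K F h) x - flow f h x))
            \<in> O[at_right 0](\<lambda>h. h ^ (K + 2))) \<and>
     (\<forall>x. (\<lambda>h. norm ((\<Phi> h (truncated_field K F h) ^^ S) x - flow f (real S * h) x))
            \<in> O[at_right 0](\<lambda>h. h ^ (K + 2)))"
proof (rule ex_ex1I)
  obtain F where F: "\<And>k. smooth (F k)"
    "loc_bigo (K + 2) (\<lambda>h y. \<Phi> h (truncated_field K F h) y - flow f h y)"
    by (rule exists_modified_field[OF assms(2,3,1)]) blast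
  \<comment> \<open>Uniqueness is stated among functions that are \<open>undefined\<close> outside
    \<open>{..K}\<close>; \<open>truncated_field K\<close> reads only indices up to
    \<open>K\<close>, so the restriction leaves the field unchanged.\<close>
  define F' where "F' = restrict F {..K}"
  have "truncated_field K F' = truncated_field K F"
    by (simp add: fun_eq_iff truncated_field_def F'_def)
  with F(2) have F': "loc_bigo (K + 2) (\<lambda>h y. \<Phi> h (truncated_field K F' h) y - flow f h y)"
    by simp
  have "F' \<in> {..K} \<rightarrow>\<^sub>E {g. smooth g}" using F(1) by (auto simp: F'_def)
  moreover have "(\<lambda>h. norm (\<Phi> h (truncated_field K F' h) x - flow f h x))
            \<in> O[at_right 0](\<lambda>h. h ^ (K + 2))" for x
    by (rule loc_bigo_compose[OF F' tendsto_const])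
  moreover have "(\<lambda>h. norm ((\<Phi> h (truncated_field K F' h) ^^ S) x - flow f (real S * h) x))
            \<in> O[at_right 0](\<lambda>h. h ^ (K + 2))" for x
    using composition_bigo[OF assms(1), of "K + 1" "\<lambda>h. \<Phi> h (truncated_field K F' h)"] F' by simp
  ultimately show "\<exists>F. F \<in> {..K} \<rightarrow>\<^sub>E {g :: real^'n \<Rightarrow> real^'n. smooth g} \<and>
     (\<forall>x. (\<lambda>h. norm (\<Phi> h (truncated_field K F h) x - flow f h x))
            \<in> O[at_right 0](\<lambda>h. h ^ (K + 2))) \<and>
     (\<forall>x. (\<lambda>h. norm ((\<Phi> h (truncated_field K F h) ^^ S) x - flow f (real S * h) x))
            \<in> O[at_right 0](\<lambda>h. h ^ (K + 2)))"
    by blast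
next
  fix F G :: "nat \<Rightarrow> real^'n \<Rightarrow> real^'n"
  assume F: "F \<in> {..K} \<rightarrow>\<^sub>E {g :: real^'n \<Rightarrow> real^'n. smooth g} \<and>
     (\<forall>x. (\<lambda>h. norm (\<Phi> h (truncated_field K F h) x - flow f h x))
            \<in> O[at_right 0](\<lambda>h. h ^ (K + 2))) \<and>
     (\<forall>x. (\<lambda>h. norm ((\<Phi> h (truncated_field K F h) ^^ S) x - flow f (real S * h) x))
            \<in> O[at_right 0](\<lambda>h. h ^ (K + 2)))"
  assume G: "G \<in> {..K} \<rightarrow>\<^sub>E {g :: real^'n \<Rightarrow> real^'n. smooth g} \<and>
     (\<forall>x. (\<lambda>h. norm (\<Phi> h (truncated_field K G h) x - flow f h x))
            \<in> O[at_right 0](\<lambda>h. h ^ (K + 2))) \<and>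
     (\<forall>x. (\<lambda>h. norm ((\<Phi> h (truncated_field K G h) ^^ S) x - flow f (real S * h) x))
            \<in> O[at_right 0](\<lambda>h. h ^ (K + 2)))"
  \<comment> \<open>The one-step estimates determine the coefficients on \<open>{..K}\<close>;
    outside, both families are \<open>undefined\<close>.\<close>
  have "F k = G k" if "k \<in> {..K}" for k
    using F G that
    by (intro modified_field_unique[OF assms(2,3), where u = "flow f" and K = K]) auto
  then show "F = G"
    using F G by (intro PiE_ext[of F "{..K}" _ G]) auto
qed

end
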